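(* Let $T>0$ and let $\mu$ be a stochastic measure on the Borel $\sigma$-algebra of $[0,T]$ such that the process $\mu_t=\mu((0,t])$, $0\le t\le T$, has continuous paths. Suppose there exists a real-valued finite measure $\mathsf{m}$ on the Borel subsets of $[0,T]$ with the following property: if a measurable function $h:[0,T]\to\mathbb{R}$ satisfies $\int_{[0,T]}h^2\,d\mathsf{m}<+\infty$, then $h$ is integrable with respect to $\mu$ on $[0,T]$. Then for any $\delta>0$ and any $T_1$ with $0<T_1<T$, $$\frac1\varepsilon\int_{[0,T_1]}|\mu_{s+\varepsilon}-\mu_s|^{2+\delta}\,ds\to0\quad\text{in probability as }\varepsilon\to0+.$$ In particular, the process $\mu_t$ has the strong cubic variation (strong $3$-variation) $[\mu;3](t)=0$, $0\le t\le T_1$.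
   Context: Let $(\Omega,\mathcal{F},\mathsf{P})$ be a complete probability space and $L_0=L_0(\Omega,\mathcal{F},\mathsf{P})$ the space of (classes of) real-valued random variables with convergence in probability. A stochastic measure on a measurable space $(X,\mathcal{B})$ is a $\sigma$-additive mapping $\mu:\mathcal{B}\to L_0$, i.e. for pairwise disjoint $A_n\in\mathcal{B}$ one has $\mu(\bigcup_n A_n)=\sum_n\mu(A_n)$ with convergence in probability; no positivity or moment assumption is made. Integral of deterministic functions: for a simple function $g=\sum_k c_k\mathbf{1}_{A_k}$, $\int_A g\,d\mu=\sum_k c_k\mu(A\cap A_k)$. A measurable $g:X\to\mathbb{R}$ is integrable with respect to $\mu$ on $X$ if there are simple functions $g_n\to g$ pointwise such that $\int_A g_n\,d\mu$ converges in probability for every $A\in\mathcal{B}$; the limit is $\int_A g\,d\mu$. Every bounded measurable function is integrable. Strong $n$-variation: a continuous process $X_t$, $0\le t\le T$, has the strong $n$-variation on $[0,T_1]$ ($T_1<T$) if $$[X;n](t)=\lim_{\varepsilon\to0+}\frac1\varepsilon\int_{[0,t]}(X_{s+\varepsilon}-X_s)^n\,ds,\quad 0\le t\le T_1,$$ exists in the sense of uniform (in $t\in[0,T_1]$) convergence in probability, and every sequence $\varepsilon_i\to0+$ admits a subsequence $\tilde\varepsilon_i$ such that $$\sup_i\frac1{\tilde\varepsilon_i}\int_{[0,T_1]}|X_{s+\tilde\varepsilon_i}-X_s|^n\,ds<+\infty\quad\text{a.s.}$$ *)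

theory Defs
  imports "HOL-Probability.Probability"
begin

text \<open>
  Elements of $L_0$ are represented by real-valued random variables on the probability space \<open>P\<close>;
  all notions below depend only on their almost-sure equivalence classes, except that pathwise
  notions refer to a chosen version of a process.

  Measurability of the approximating functions is part of convergence in probability, since
  \<open>measure P\<close> assigns 0 to every non-measurable set.
\<close>

definition conv_in_prob ::
  "'w measure \<Rightarrow> ('i \<Rightarrow> 'w \<Rightarrow> real) \<Rightarrow> ('w \<Rightarrow> real) \<Rightarrow> 'i filter \<Rightarrow> bool" where
  "conv_in_prob P Y Z F \<longleftrightarrow>
     (\<forall>\<^sub>F i in F. Y i \<in> borel_measurable P) \<and> Z \<in> borel_measurable P \<and>
     (\<forall>e>0. ((\<lambda>i. measure P {\<omega> \<in> space P. \<bar>Y i \<omega> - Z \<omega>\<bar> > e}) \<longlongrightarrow> 0) F)"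

text \<open>The supremum is taken in \<open>ennreal\<close>, where it is meaningful for unbounded families.\<close>

definition unif_conv_in_prob ::
  "'w measure \<Rightarrow> 't set \<Rightarrow> ('i \<Rightarrow> 't \<Rightarrow> 'w \<Rightarrow> real) \<Rightarrow> ('t \<Rightarrow> 'w \<Rightarrow> real) \<Rightarrow> 'i filter \<Rightarrow> bool" where
  "unif_conv_in_prob P S Y Z F \<longleftrightarrow>
     (\<forall>t\<in>S. (\<forall>\<^sub>F i in F. Y i t \<in> borel_measurable P) \<and> Z t \<in> borel_measurable P) \<and>
     (\<forall>\<^sub>F i in F. (\<lambda>\<omega>. SUP t\<in>S. ennreal \<bar>Y i t \<omega> - Z t \<omega>\<bar>) \<in> borel_measurable P) \<and>
     (\<forall>e>0. ((\<lambda>i. measure P {\<omega> \<in> space P. (SUP t\<in>S. ennreal \<bar>Y i t \<omega> - Z t \<omega>\<bar>) > ennreal e})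
              \<longlongrightarrow> 0) F)"

text \<open>Only the measurable space underlying \<open>N\<close> is used, here and in the integral.\<close>

definition stochastic_measure ::
  "'w measure \<Rightarrow> 'x measure \<Rightarrow> ('x set \<Rightarrow> 'w \<Rightarrow> real) \<Rightarrow> bool" where
  "stochastic_measure P N \<mu> \<longleftrightarrow>
     (\<forall>A\<in>sets N. \<mu> A \<in> borel_measurable P) \<and>
     (\<forall>A :: nat \<Rightarrow> 'x set. range A \<subseteq> sets N \<longrightarrow> disjoint_family A \<longrightarrow>
        conv_in_prob P (\<lambda>n \<omega>. \<Sum>k<n. \<mu> (A k) \<omega>) (\<mu> (\<Union>k. A k)) sequentially)"

text \<open>
  A simple function is integrated through its canonical representation over its level sets, as in
  \<open>simple_integral\<close>; by additivity of \<open>\<mu>\<close> any other representation gives the same value almost surely.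
\<close>

definition stoch_simple_integral ::
  "'x measure \<Rightarrow> ('x set \<Rightarrow> 'w \<Rightarrow> real) \<Rightarrow> 'x set \<Rightarrow> ('x \<Rightarrow> real) \<Rightarrow> 'w \<Rightarrow> real" where
  "stoch_simple_integral N \<mu> A g \<omega> =
     (\<Sum>c\<in>g ` space N. c * \<mu> (A \<inter> (g -` {c} \<inter> space N)) \<omega>)"

definition stoch_integrable ::
  "'w measure \<Rightarrow> 'x measure \<Rightarrow> ('x set \<Rightarrow> 'w \<Rightarrow> real) \<Rightarrow> ('x \<Rightarrow> real) \<Rightarrow> bool" where
  "stoch_integrable P N \<mu> g \<longleftrightarrow>
     g \<in> borel_measurable N \<and>
     (\<exists>gs :: nat \<Rightarrow> 'x \<Rightarrow> real.
        (\<forall>n. simple_function N (gs n)) \<and>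
        (\<forall>x\<in>space N. (\<lambda>n. gs n x) \<longlonglongrightarrow> g x) \<and>
        (\<forall>A\<in>sets N. \<exists>Z. conv_in_prob P (\<lambda>n. stoch_simple_integral N \<mu> A (gs n)) Z sequentially))"

definition continuous_process :: "'w measure \<Rightarrow> real \<Rightarrow> (real \<Rightarrow> 'w \<Rightarrow> real) \<Rightarrow> bool" where
  "continuous_process P T X \<longleftrightarrow>
     (\<forall>t\<in>{0..T}. X t \<in> borel_measurable P) \<and>
     (\<forall>\<omega>\<in>space P. continuous_on {0..T} (\<lambda>t. X t \<omega>))"

text \<open>
  \<open>has_strong_variation P T X n T1 V\<close>: the process \<open>X\<close> on $[0,T]$ has the strong \<open>n\<close>-variation on
  $[0,T_1]$ and $[X;n](t) = V_t$ there. Values of \<open>X\<close> outside $[0,T]$ enter only for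
  $\varepsilon > T - T_1$; they do not matter, because the first limit is at 0 and because
  finitely many terms can be dropped from the subsequence in the second condition.
\<close>

definition has_strong_variation ::
  "'w measure \<Rightarrow> real \<Rightarrow> (real \<Rightarrow> 'w \<Rightarrow> real) \<Rightarrow> nat \<Rightarrow> real \<Rightarrow> (real \<Rightarrow> 'w \<Rightarrow> real) \<Rightarrow> bool" where
  "has_strong_variation P T X n T1 V \<longleftrightarrow>
     continuous_process P T X \<and> T1 < T \<and>
     unif_conv_in_prob P {0..T1}
       (\<lambda>\<epsilon> t \<omega>. 1 / \<epsilon> * (LINT s:{0..t}|lborel. (X (s + \<epsilon>) \<omega> - X s \<omega>) ^ n)) V (at_right 0) \<and>
     (\<forall>\<epsilon> :: nat \<Rightarrow> real. (\<forall>i. 0 < \<epsilon> i) \<longrightarrow> \<epsilon> \<longlonglongrightarrow> 0 \<longrightarrow>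
        (\<exists>r :: nat \<Rightarrow> nat. strict_mono r \<and>
           (AE \<omega> in P. bdd_above (range (\<lambda>i.
              1 / \<epsilon> (r i) * (LINT s:{0..T1}|lborel. \<bar>X (s + \<epsilon> (r i)) \<omega> - X s \<omega>\<bar> ^ n))))))"

end

theory Submission
  imports Defs
begin

text \<open>
  Write $W_\varepsilon = \varepsilon^{-1}\int_0^{T_1} (X_{s+\varepsilon}-X_s)^2\,ds$.
  The integral of $|X_{s+\varepsilon}-X_s|^{2+\delta}/\varepsilon$ is at most
  $\sup_s |X_{s+\varepsilon}-X_s|^\delta \, W_\varepsilon$, and the supremum tends to 0 because paths
  are uniformly continuous on $[0,T]$. So everything follows once the family $W_\varepsilon$
  is bounded in probability as $\varepsilon\to 0$. This is proved by contradiction, with a gliding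
  hump: if $W_\varepsilon$ were unbounded in probability, there would be disjoint sets $R_n$ and $c>0$ with
  $P(|\mu(R_n)|\ge 1)\ge c$ for all \<open>n\<close>, although the terms of the convergent series
  $\sum_n \mu(R_n)$ tend to 0 in probability (\<open>stoch_measure.terms_vanish\<close>).

  The sets come from a random choice. Cut the line into blocks of length $2\varepsilon$ and
  choose in each block, independently and with probability $1/q$ only, one window
  $(s,s+\varepsilon]$ with uniformly distributed start \<open>s\<close> in one half of the block, and a random sign.
  The windows are disjoint. For a fixed path the sum of the signed increments over the chosen windows
  is a sum of independent centred variables; its second moment is the part of $W_\varepsilon$ that
  belongs to these halves, divided by \<open>q\<close>. Since the single increments are bounded, a fourth moment
  bound shows that the sum is large with probability at least $1/16$ when that part is
  (\<open>random_signed_selection\<close>), whatever \<open>q\<close> is. The independent choice of the starts is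
  essential: it replaces an average of squares over all grids, which cannot be controlled grid by grid
  because averages of families bounded in probability may be unbounded, by one random sum.

  On the other hand a given point lies in a chosen window with probability at most $1/q$
  (\<open>random_windows_cover_rarely\<close>). So for large \<open>q\<close> the chosen windows catch little of
  the energy $W_{\varepsilon'}$, for all smaller scales $\varepsilon'$ as well, and some fixed choice
  both has a large increment and leaves a complement on which the energy is unbounded with almost the
  same probability (\<open>split_off_windows\<close>). Repeating the step on the complement yields
  the sets $R_n$ (\<open>gliding_hump\<close>).
\<close>

section \<open>Anti-concentration of centred independent sums\<close>

text \<open>
  The Paley--Zygmund inequality. Off the event, $Y^2$ is below $v/2$; on it,
  the mean inequality $Y^2 \le Y^4/(16v) + 4v$ is used. Taking expectations leaves
  $v/4 \le 4v\,P(Y^2\ge v/2)$.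
\<close>

lemma (in prob_space) anticoncentration_of_fourth_moment:
  fixes Y :: "'a \<Rightarrow> real"
  assumes Y[measurable]: "Y \<in> borel_measurable M"
    and int4: "integrable M (\<lambda>\<omega>. Y \<omega> ^ 4)" and int2: "integrable M (\<lambda>\<omega>. (Y \<omega>)\<^sup>2)"
    and v: "expectation (\<lambda>\<omega>. (Y \<omega>)\<^sup>2) = v" "v > 0"
    and le: "expectation (\<lambda>\<omega>. Y \<omega> ^ 4) \<le> 4 * v\<^sup>2"
  shows "prob {\<omega> \<in> space M. (Y \<omega>)\<^sup>2 \<ge> v / 2} \<ge> 1 / 16"
proof -
  let ?E = "{\<omega> \<in> space M. (Y \<omega>)\<^sup>2 \<ge> v / 2}"
  have pointwise: "(Y \<omega>)\<^sup>2 \<le> v / 2 + (1 / (16 * v) * Y \<omega> ^ 4 + 4 * v * indicator ?E \<omega>)"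
    if "\<omega> \<in> space M" for \<omega>
  proof (cases "\<omega> \<in> ?E")
    case True
    have "0 \<le> ((Y \<omega>)\<^sup>2 - 8 * v)\<^sup>2 / (16 * v)"
      using v by simp
    also have "\<dots> = 1 / (16 * v) * Y \<omega> ^ 4 + 4 * v - (Y \<omega>)\<^sup>2"
      using v by (simp add: field_simps power2_eq_square power4_eq_xxxx)
    finally show ?thesis
      using v True by simp
  next
    case False
    then have "(Y \<omega>)\<^sup>2 < v / 2" and "0 \<le> 1 / (16 * v) * Y \<omega> ^ 4"
      using v that by (auto simp: not_le)
    then show ?thesis
      using False by simp
  qed
  have int_E: "integrable M (indicat_real ?E)"
    by (simp add: less_top[symmetric])
  have "v = expectation (\<lambda>\<omega>. (Y \<omega>)\<^sup>2)"
    using v by simp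
  also have "\<dots> \<le> expectation (\<lambda>\<omega>. v / 2 + (1 / (16 * v) * Y \<omega> ^ 4 + 4 * v * indicator ?E \<omega>))"
    by (rule integral_mono[OF int2 _ pointwise]) (use int4 int_E in simp)
  also have "\<dots> = v / 2 + (1 / (16 * v) * expectation (\<lambda>\<omega>. Y \<omega> ^ 4) + 4 * v * prob ?E)"
    using int4 int_E by (simp add: prob_space del: divide_le_eq_numeral1)
  also have "\<dots> \<le> v / 2 + (1 / (16 * v) * (4 * v\<^sup>2) + 4 * v * prob ?E)"
    using v le by (intro add_left_mono add_right_mono mult_left_mono) auto
  finally show ?thesis
    using v by (simp add: field_simps power2_eq_square)
qed

text \<open>
  Adding one variable at a time, all terms of $(\psi_j+S)^4$ that contain $\psi_j$ or \<open>S\<close> to the first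
  power have expectation 0. What remains is $E\psi_j^4 + 6\,E\psi_j^2\,ES^2 + ES^4$, and $E\psi_j^4 \le B^2 E\psi_j^2$.
\<close>

lemma (in prob_space) moments_of_centred_indep_sum:
  fixes \<psi> :: "'i \<Rightarrow> 'a \<Rightarrow> real"
  assumes "finite I" and "indep_vars (\<lambda>_. borel) \<psi> I"
    and "\<And>i \<omega>. i \<in> I \<Longrightarrow> \<omega> \<in> space M \<Longrightarrow> \<bar>\<psi> i \<omega>\<bar> \<le> B"
    and "\<And>i. i \<in> I \<Longrightarrow> expectation (\<psi> i) = 0"
  defines "v \<equiv> \<Sum>i\<in>I. expectation (\<lambda>\<omega>. (\<psi> i \<omega>)\<^sup>2)"
  shows "expectation (\<lambda>\<omega>. (\<Sum>i\<in>I. \<psi> i \<omega>)\<^sup>2) = v"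
    and "expectation (\<lambda>\<omega>. (\<Sum>i\<in>I. \<psi> i \<omega>) ^ 4) \<le> 3 * v\<^sup>2 + B\<^sup>2 * v"
    and "expectation (\<lambda>\<omega>. \<Sum>i\<in>I. \<psi> i \<omega>) = 0"
    and "\<And>k. integrable M (\<lambda>\<omega>. (\<Sum>i\<in>I. \<psi> i \<omega>) ^ k)"
proof -
  have int_power: "integrable M (\<lambda>\<omega>. (\<Sum>i\<in>J. \<psi> i \<omega>) ^ k)" if "J \<subseteq> I" for J k
  proof (rule integrable_const_bound[where B = "(\<Sum>i\<in>J. B) ^ k"])
    have rv: "\<psi> i \<in> borel_measurable M" if "i \<in> I" for i
      using assms(2) that by (auto simp: indep_vars_def)
    show "(\<lambda>\<omega>. (\<Sum>i\<in>J. \<psi> i \<omega>) ^ k) \<in> borel_measurable M"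
      using rv \<open>J \<subseteq> I\<close> by (auto intro!: borel_measurable_power borel_measurable_sum)
    have "\<bar>\<Sum>i\<in>J. \<psi> i \<omega>\<bar> \<le> (\<Sum>i\<in>J. B)" if "\<omega> \<in> space M" for \<omega>
      using assms(3)[OF _ that] \<open>J \<subseteq> I\<close>
      by (intro order.trans[OF sum_abs] sum_mono) auto
    then show "AE \<omega> in M. norm ((\<Sum>i\<in>J. \<psi> i \<omega>) ^ k) \<le> (\<Sum>i\<in>J. B) ^ k"
      by (intro AE_I2) (auto simp: power_abs intro!: power_mono)
  qed
  then show "\<And>k. integrable M (\<lambda>\<omega>. (\<Sum>i\<in>I. \<psi> i \<omega>) ^ k)"
    by simp
  have "J \<subseteq> I \<Longrightarrow>
      expectation (\<lambda>\<omega>. \<Sum>i\<in>J. \<psi> i \<omega>) = 0 \<and>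
      expectation (\<lambda>\<omega>. (\<Sum>i\<in>J. \<psi> i \<omega>)\<^sup>2) = (\<Sum>i\<in>J. expectation (\<lambda>\<omega>. (\<psi> i \<omega>)\<^sup>2)) \<and>
      expectation (\<lambda>\<omega>. (\<Sum>i\<in>J. \<psi> i \<omega>) ^ 4)
        \<le> 3 * (\<Sum>i\<in>J. expectation (\<lambda>\<omega>. (\<psi> i \<omega>)\<^sup>2))\<^sup>2 + B\<^sup>2 * (\<Sum>i\<in>J. expectation (\<lambda>\<omega>. (\<psi> i \<omega>)\<^sup>2))"
    if "finite J" for J
    using that
  proof (induction J rule: finite_induct)
    case empty
    then show ?case by simp
  next
    case (insert j J)
    define S where "S = (\<lambda>\<omega>. \<Sum>i\<in>J. \<psi> i \<omega>)"
    define w where "w = expectation (\<lambda>\<omega>. (\<psi> j \<omega>)\<^sup>2)"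
    define u where "u = (\<Sum>i\<in>J. expectation (\<lambda>\<omega>. (\<psi> i \<omega>)\<^sup>2))"
    have j: "j \<in> I" and J: "J \<subseteq> I"
      using insert by auto
    have IH: "expectation S = 0" "expectation (\<lambda>\<omega>. (S \<omega>)\<^sup>2) = u"
        "expectation (\<lambda>\<omega>. S \<omega> ^ 4) \<le> 3 * u\<^sup>2 + B\<^sup>2 * u"
      using insert.IH[OF J] by (simp_all add: S_def u_def)
    have S_int[simp]: "integrable M (\<lambda>\<omega>. S \<omega> ^ k)" for k
      using int_power[OF J, of k] by (simp add: S_def)
    have \<psi>_int[simp]: "integrable M (\<lambda>\<omega>. \<psi> j \<omega> ^ k)" for k
      using int_power[of "{j}" k] j by simp
    have indep: "indep_var borel (\<psi> j) borel S"
      unfolding S_def using insert j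
      by (intro indep_vars_sum indep_vars_subset[OF assms(2)]) auto
    have pow: "indep_var borel (\<lambda>\<omega>. \<psi> j \<omega> ^ k) borel (\<lambda>\<omega>. S \<omega> ^ l)" for k l
      using indep_var_compose[OF indep, of "\<lambda>x. x ^ k" borel "\<lambda>x. x ^ l" borel]
      by (simp add: comp_def)
    have mix: "expectation (\<lambda>\<omega>. \<psi> j \<omega> ^ k * S \<omega> ^ l)
        = expectation (\<lambda>\<omega>. \<psi> j \<omega> ^ k) * expectation (\<lambda>\<omega>. S \<omega> ^ l)"
      and mix_int: "integrable M (\<lambda>\<omega>. \<psi> j \<omega> ^ k * S \<omega> ^ l)" for k l
      by (rule indep_var_lebesgue_integral[OF pow] indep_var_integrable[OF pow]; simp)+
    have E1: "expectation (\<lambda>\<omega>. \<psi> j \<omega> + S \<omega>) = 0"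
      using S_int[of 1] \<psi>_int[of 1] assms(4)[OF j] IH by simp
    have "expectation (\<lambda>\<omega>. (\<psi> j \<omega> + S \<omega>)\<^sup>2)
        = expectation (\<lambda>\<omega>. \<psi> j \<omega> ^ 2 + (2 * (\<psi> j \<omega> ^ 1 * S \<omega> ^ 1) + S \<omega> ^ 2))"
      by (intro Bochner_Integration.integral_cong) (auto simp: power2_eq_square algebra_simps)
    also have "\<dots> = w + u"
      using mix[of 1 1] mix_int[of 1 1] assms(4)[OF j] IH by (simp add: w_def)
    finally have E2: "expectation (\<lambda>\<omega>. (\<psi> j \<omega> + S \<omega>)\<^sup>2) = w + u" .
    have "expectation (\<lambda>\<omega>. (\<psi> j \<omega> + S \<omega>) ^ 4)
        = expectation (\<lambda>\<omega>. \<psi> j \<omega> ^ 4 + (4 * (\<psi> j \<omega> ^ 3 * S \<omega> ^ 1)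
            + (6 * (\<psi> j \<omega> ^ 2 * S \<omega> ^ 2) + (4 * (\<psi> j \<omega> ^ 1 * S \<omega> ^ 3) + S \<omega> ^ 4))))"
      by (intro Bochner_Integration.integral_cong)
         (auto simp: power2_eq_square power4_eq_xxxx power3_eq_cube algebra_simps)
    also have "\<dots> = expectation (\<lambda>\<omega>. \<psi> j \<omega> ^ 4) + (4 * expectation (\<lambda>\<omega>. \<psi> j \<omega> ^ 3 * S \<omega> ^ 1)
            + (6 * expectation (\<lambda>\<omega>. \<psi> j \<omega> ^ 2 * S \<omega> ^ 2) + (4 * expectation (\<lambda>\<omega>. \<psi> j \<omega> ^ 1 * S \<omega> ^ 3)
            + expectation (\<lambda>\<omega>. S \<omega> ^ 4))))"
      using mix_int[of 3 1] mix_int[of 2 2] mix_int[of 1 3] by simp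
    also have "\<dots> = expectation (\<lambda>\<omega>. \<psi> j \<omega> ^ 4) + 6 * w * u + expectation (\<lambda>\<omega>. S \<omega> ^ 4)"
      using mix[of 3 1] mix[of 2 2] mix[of 1 3] assms(4)[OF j] IH by (simp add: w_def)
    finally have E4: "expectation (\<lambda>\<omega>. (\<psi> j \<omega> + S \<omega>) ^ 4)
        = expectation (\<lambda>\<omega>. \<psi> j \<omega> ^ 4) + 6 * w * u + expectation (\<lambda>\<omega>. S \<omega> ^ 4)" .
    have "\<psi> j \<omega> ^ 4 \<le> B\<^sup>2 * \<psi> j \<omega> ^ 2" if "\<omega> \<in> space M" for \<omega>
    proof -
      have "(\<psi> j \<omega>)\<^sup>2 \<le> B\<^sup>2"
        using assms(3)[OF j that] by (metis abs_ge_zero power2_abs power_mono)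
      then have "(\<psi> j \<omega>)\<^sup>2 * (\<psi> j \<omega>)\<^sup>2 \<le> B\<^sup>2 * (\<psi> j \<omega>)\<^sup>2"
        by (rule mult_right_mono) simp
      then show ?thesis
        by (simp add: power2_eq_square power4_eq_xxxx algebra_simps)
    qed
    then have "expectation (\<lambda>\<omega>. \<psi> j \<omega> ^ 4) \<le> expectation (\<lambda>\<omega>. B\<^sup>2 * \<psi> j \<omega> ^ 2)"
      by (intro integral_mono) auto
    then have "expectation (\<lambda>\<omega>. \<psi> j \<omega> ^ 4) \<le> B\<^sup>2 * w"
      by (simp add: w_def)
    then have "expectation (\<lambda>\<omega>. (\<psi> j \<omega> + S \<omega>) ^ 4) \<le> B\<^sup>2 * w + 6 * w * u + (3 * u\<^sup>2 + B\<^sup>2 * u)"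
      using E4 IH(3) by linarith
    also have "\<dots> \<le> 3 * (w + u)\<^sup>2 + B\<^sup>2 * (w + u)"
      using zero_le_power2[of w] by (simp add: power2_eq_square algebra_simps)
    finally show ?case
      using insert.hyps E1 E2 by (simp add: S_def w_def[symmetric] u_def[symmetric])
  qed
  from this[OF assms(1)] show
    "expectation (\<lambda>\<omega>. (\<Sum>i\<in>I. \<psi> i \<omega>)\<^sup>2) = v"
    "expectation (\<lambda>\<omega>. (\<Sum>i\<in>I. \<psi> i \<omega>) ^ 4) \<le> 3 * v\<^sup>2 + B\<^sup>2 * v"
    "expectation (\<lambda>\<omega>. \<Sum>i\<in>I. \<psi> i \<omega>) = 0"
    by (auto simp: v_def)
qed

text \<open>
  Once the variance is at least $B^2$, the fourth moment is at most four times its square, so that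
  the lower bound $1/16$ depends neither on the number nor on the distribution of the summands.
\<close>

lemma (in prob_space) anticoncentration_of_centred_indep_sum:
  fixes \<psi> :: "'i \<Rightarrow> 'a \<Rightarrow> real"
  assumes "finite I" and ind: "indep_vars (\<lambda>_. borel) \<psi> I"
    and "\<And>i \<omega>. i \<in> I \<Longrightarrow> \<omega> \<in> space M \<Longrightarrow> \<bar>\<psi> i \<omega>\<bar> \<le> B"
    and "\<And>i. i \<in> I \<Longrightarrow> expectation (\<psi> i) = 0"
    and v: "(\<Sum>i\<in>I. expectation (\<lambda>\<omega>. (\<psi> i \<omega>)\<^sup>2)) \<ge> v" "v > 0" "v \<ge> B\<^sup>2"
  shows "prob {\<omega> \<in> space M. (\<Sum>i\<in>I. \<psi> i \<omega>)\<^sup>2 \<ge> v / 2} \<ge> 1 / 16"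
proof -
  let ?v = "\<Sum>i\<in>I. expectation (\<lambda>\<omega>. (\<psi> i \<omega>)\<^sup>2)"
  note m = moments_of_centred_indep_sum[OF assms(1-4)]
  have [measurable]: "(\<lambda>\<omega>. \<Sum>i\<in>I. \<psi> i \<omega>) \<in> borel_measurable M"
    using ind by (intro borel_measurable_sum) (auto simp: indep_vars_def)
  have "B\<^sup>2 * ?v \<le> ?v * ?v"
    using v by (intro mult_right_mono) auto
  then have "expectation (\<lambda>\<omega>. (\<Sum>i\<in>I. \<psi> i \<omega>) ^ 4) \<le> 4 * ?v\<^sup>2"
    using m(2) by (simp add: power2_eq_square)
  then have "1 / 16 \<le> prob {\<omega> \<in> space M. (\<Sum>i\<in>I. \<psi> i \<omega>)\<^sup>2 \<ge> ?v / 2}"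
    using m v by (intro anticoncentration_of_fourth_moment) auto
  also have "\<dots> \<le> prob {\<omega> \<in> space M. (\<Sum>i\<in>I. \<psi> i \<omega>)\<^sup>2 \<ge> v / 2}"
    using v by (intro finite_measure_mono) auto
  finally show ?thesis .
qed

lemma indep_vars_coordinates:
  assumes N: "prob_space N" and I: "finite I" and f: "\<And>i. i \<in> I \<Longrightarrow> f i \<in> borel_measurable N"
  shows "prob_space.indep_vars (PiM I (\<lambda>_. N)) (\<lambda>_. borel) (\<lambda>i \<theta>. f i (\<theta> i)) I"
proof -
  interpret N: prob_space N by fact
  interpret Pr: prob_space "PiM I (\<lambda>_. N)"
    by (rule prob_space_PiM) (rule N)
  have "Pr.indep_vars (\<lambda>_. N) (\<lambda>i \<theta>. \<theta> i) I"
  proof (cases "I = {}")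
    case False
    have "distr (PiM I (\<lambda>_. N)) (PiM I (\<lambda>_. N)) (\<lambda>\<theta>. \<lambda>i\<in>I. \<theta> i) = distr (PiM I (\<lambda>_. N)) (PiM I (\<lambda>_. N)) (\<lambda>\<theta>. \<theta>)"
      by (intro distr_cong) (auto simp: space_PiM PiE_restrict)
    also have "\<dots> = PiM I (\<lambda>_. N)"
      by (simp add: distr_id2)
    also have "\<dots> = PiM I (\<lambda>i. distr (PiM I (\<lambda>_. N)) N (\<lambda>\<theta>. \<theta> i))"
      by (intro PiM_cong refl distr_PiM_component[symmetric] N)
    finally show ?thesis
      using False by (subst Pr.indep_vars_iff_distr_eq_PiM') (auto intro: measurable_component_singleton)
  next
    case True
    then show ?thesis
      unfolding Pr.indep_vars_def Pr.indep_sets_def by auto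
  qed
  from Pr.indep_vars_compose2[OF this, of f "\<lambda>_. borel"] f show ?thesis
    by simp
qed

section \<open>Random signed points, and processes with bounded uniformly continuous paths\<close>

text \<open>
  One real coordinate encodes the choice in one block: the block is used if $0<|t|<1$, which has
  probability $1/q$; then $|t|$ is the uniformly distributed position and the sign of \<open>t\<close> is the random sign.
\<close>

definition sym_unif :: "real \<Rightarrow> real measure" where
  "sym_unif q = uniform_measure lborel {- q..q}"

lemma sets_sym_unif[measurable_cong, simp]: "sets (sym_unif q) = sets borel"
  by (simp add: sym_unif_def)

lemma space_sym_unif[simp]: "space (sym_unif q) = UNIV"
  by (simp add: sym_unif_def)

lemma prob_space_sym_unif: "q > 0 \<Longrightarrow> prob_space (sym_unif q)"
  unfolding sym_unif_def by (rule prob_space_uniform_measure) auto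

lemma nn_integral_sym_unif:
  assumes "f \<in> borel_measurable borel" "q > 0"
  shows "(\<integral>\<^sup>+t. f t \<partial>sym_unif q) = (\<integral>\<^sup>+t\<in>{-q..q}. f t \<partial>lborel) / ennreal (2 * q)"
  using assms unfolding sym_unif_def by (subst nn_integral_uniform_measure) auto

lemma integral_sym_unif_odd:
  fixes f :: "real \<Rightarrow> real"
  assumes f[measurable]: "f \<in> borel_measurable borel" and odd: "\<And>t. f (- t) = - f t" and q: "q > 0"
  shows "(\<integral>t. f t \<partial>sym_unif q) = 0"
proof -
  have "sym_unif q = density lborel (\<lambda>t. ennreal (indicator {-q..q} t / (2 * q)))"
    unfolding sym_unif_def uniform_measure_def using q
    by (intro density_cong) (auto split: split_indicator simp: divide_ennreal ennreal_1[symmetric] simp del: ennreal_1)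
  then have *: "(\<integral>t. f t \<partial>sym_unif q) = (\<integral>t. indicator {-q..q} t / (2 * q) * f t \<partial>lborel)"
    using q by (simp add: integral_density)
  also have "\<dots> = (\<integral>t. indicator {-q..q} (0 + (-1) * t) / (2 * q) * f (0 + (-1) * t) \<partial>lborel)"
    by (subst lborel_integral_real_affine[where c = "-1" and t = 0]) auto
  also have "\<dots> = (\<integral>t. - (indicator {-q..q} t / (2 * q) * f t) \<partial>lborel)"
    using odd by (intro Bochner_Integration.integral_cong) (auto split: split_indicator)
  also have "\<dots> = - (\<integral>t. f t \<partial>sym_unif q)"
    unfolding * by simp
  finally show ?thesis by simp
qed

text \<open>
  The points 0 and 1 are negligible, so the half-open interval, over which the blocks are parametrised
  later, may stand on the right-hand side.
\<close>

lemma nn_integral_sym_unif_even: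
  fixes g :: "real \<Rightarrow> ennreal"
  assumes g[measurable]: "g \<in> borel_measurable borel" and q: "q \<ge> 1"
  shows "(\<integral>\<^sup>+t. g \<bar>t\<bar> * indicator {t. 0 < \<bar>t\<bar> \<and> \<bar>t\<bar> < 1} t \<partial>sym_unif q)
    = (\<integral>\<^sup>+u\<in>{0..<1}. g u \<partial>lborel) / ennreal q"
proof -
  let ?I = "\<integral>\<^sup>+u\<in>{0..<1}. g u \<partial>lborel"
  have pos: "(\<integral>\<^sup>+t. g t * indicator {0<..<1} t \<partial>lborel) = ?I"
    by (rule nn_integral_cong_AE) (use AE_lborel_singleton[of 0] in \<open>eventually_elim; auto split: split_indicator\<close>)
  have "(\<integral>\<^sup>+t. g (- t) * indicator {-1<..<0} t \<partial>lborel)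
      = (\<integral>\<^sup>+t. g (- (0 + (-1) * t)) * indicator {-1<..<0} (0 + (-1) * t) \<partial>lborel)"
    by (subst nn_integral_real_affine[where c = "-1" and t = 0]) auto
  also have "\<dots> = (\<integral>\<^sup>+t. g t * indicator {0<..<1} t \<partial>lborel)"
    by (intro nn_integral_cong) (auto split: split_indicator)
  finally have neg: "(\<integral>\<^sup>+t. g (- t) * indicator {-1<..<0} t \<partial>lborel) = ?I"
    using pos by simp
  have "(\<integral>\<^sup>+t. g \<bar>t\<bar> * indicator {t. 0 < \<bar>t\<bar> \<and> \<bar>t\<bar> < 1} t \<partial>sym_unif q)
      = (\<integral>\<^sup>+t. g \<bar>t\<bar> * indicator {t. 0 < \<bar>t\<bar> \<and> \<bar>t\<bar> < 1} t * indicator {-q..q} t \<partial>lborel) / ennreal (2 * q)"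
    using q by (subst nn_integral_sym_unif) auto
  also have "(\<integral>\<^sup>+t. g \<bar>t\<bar> * indicator {t. 0 < \<bar>t\<bar> \<and> \<bar>t\<bar> < 1} t * indicator {-q..q} t \<partial>lborel)
      = (\<integral>\<^sup>+t. g t * indicator {0<..<1} t + g (- t) * indicator {-1<..<0} t \<partial>lborel)"
    using q by (intro nn_integral_cong) (auto split: split_indicator)
  also have "\<dots> = 2 * ?I"
    using pos neg by (simp add: nn_integral_add mult_2)
  also have "2 * ?I / ennreal (2 * q) = ?I / ennreal q"
  proof -
    have "ennreal 2 * ennreal (1 / (2 * q)) = ennreal (1 / q)"
      using q by (subst ennreal_mult[symmetric]) auto
    then have "?I * (ennreal 2 * ennreal (1 / (2 * q))) = ?I * ennreal (1 / q)"
      by simp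
    then show ?thesis
      using q by (simp add: divide_ennreal_def inverse_ennreal inverse_eq_divide mult_ac)
  qed
  finally show ?thesis .
qed

text \<open>
  If every point of \<open>A\<close> had $J_n > b$ eventually, Fatou's lemma would give $b\,P(A) \le r$. A single point
  that is good for infinitely many \<open>n\<close> is needed because the energy must stay large at arbitrarily
  small scales after one fixed set has been removed.
\<close>

lemma (in prob_space) some_point_small_infinitely_often:
  fixes J :: "nat \<Rightarrow> 'a \<Rightarrow> ennreal"
  assumes A[measurable]: "A \<in> events" and c: "prob A \<ge> c" "c > 0"
    and J[measurable]: "\<And>n. J n \<in> borel_measurable M"
    and r: "\<And>n. (\<integral>\<^sup>+\<omega>. J n \<omega> \<partial>M) \<le> ennreal r" "0 \<le> r" "r < c * b"
  shows "\<exists>\<omega>\<in>A. \<exists>\<^sub>F n in sequentially. J n \<omega> \<le> ennreal b"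
proof (rule ccontr)
  assume "\<not> ?thesis"
  then have ev: "\<forall>\<^sub>F n in sequentially. ennreal b \<le> J n \<omega>" if "\<omega> \<in> A" for \<omega>
    using that by (auto simp: not_frequently not_le intro: eventually_mono less_imp_le)
  have b: "b > 0"
    using r c by (smt (verit) mult_nonneg_nonpos)
  have "ennreal b * indicator A \<omega> \<le> liminf (\<lambda>n. J n \<omega>)" for \<omega>
    using ev[of \<omega>] by (auto split: split_indicator intro!: Liminf_bounded)
  then have "(\<integral>\<^sup>+\<omega>. ennreal b * indicator A \<omega> \<partial>M) \<le> (\<integral>\<^sup>+\<omega>. liminf (\<lambda>n. J n \<omega>) \<partial>M)"
    by (intro nn_integral_mono) auto
  also have "\<dots> \<le> liminf (\<lambda>n. \<integral>\<^sup>+\<omega>. J n \<omega> \<partial>M)"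
    by (rule nn_integral_liminf) simp
  also have "\<dots> \<le> ennreal r"
    using r(1) by (intro Liminf_le) auto
  finally have "ennreal (b * prob A) \<le> ennreal r"
    using b by (simp add: nn_integral_cmult emeasure_eq_measure ennreal_mult)
  then have "b * prob A \<le> r"
    using r by simp
  moreover have "b * c \<le> b * prob A"
    using b c by simp
  ultimately show False
    using r by (simp add: mult.commute)
qed

lemma (in prob_space) prob_large_of_integral:
  fixes H :: "'a \<Rightarrow> real"
  assumes H[measurable]: "H \<in> borel_measurable M" and "\<And>\<omega>. \<omega> \<in> space M \<Longrightarrow> H \<omega> \<le> 1"
    and "(\<integral>\<^sup>+\<omega>. ennreal (H \<omega>) \<partial>M) \<ge> ennreal (2 * c)" "c > 0"
  shows "prob {\<omega> \<in> space M. H \<omega> \<ge> c} \<ge> c"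
proof -
  let ?E = "{\<omega> \<in> space M. H \<omega> \<ge> c}"
  have "ennreal (2 * c) \<le> (\<integral>\<^sup>+\<omega>. ennreal (H \<omega>) \<partial>M)"
    by fact
  also have "\<dots> \<le> (\<integral>\<^sup>+\<omega>. ennreal c + indicator ?E \<omega> \<partial>M)"
  proof (rule nn_integral_mono)
    fix \<omega> assume \<omega>: "\<omega> \<in> space M"
    show "ennreal (H \<omega>) \<le> ennreal c + indicator ?E \<omega>"
    proof (cases "\<omega> \<in> ?E")
      case True
      then show ?thesis
        using assms(2)[OF \<omega>] by (auto intro: order.trans[of _ 1] simp: add_increasing)
    next
      case False
      then show ?thesis
        using \<omega> by (auto intro: ennreal_leI)
    qed
  qed
  also have "\<dots> = ennreal (c + prob ?E)"
    using assms(4) by (simp add: nn_integral_add emeasure_eq_measure prob_space)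
  finally have "2 * c \<le> c + prob ?E"
    using assms(4) by (subst (asm) ennreal_le_iff) auto
  then show ?thesis
    by simp
qed

text \<open>
  This makes events about all times of a continuous path measurable.
\<close>

lemma continuous_le_iff_rat:
  fixes f :: "real \<Rightarrow> real"
  assumes "continuous_on UNIV f"
  shows "(\<forall>x. f x \<le> b) \<longleftrightarrow> (\<forall>r::rat. f (of_rat r) \<le> b)"
proof safe
  fix x assume r: "\<forall>r::rat. f (of_rat r) \<le> b"
  show "f x \<le> b"
  proof (rule ccontr)
    assume "\<not> f x \<le> b"
    moreover have "open {x. b < f x}"
      using assms by (intro open_Collect_less) auto
    ultimately obtain e where e: "e > 0" "ball x e \<subseteq> {x. b < f x}"
      by (auto simp: open_contains_ball not_le)
    obtain r :: rat where "x < of_rat r" "of_rat r < x + e"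
      using of_rat_dense[of x "x + e"] e by auto
    then have "of_rat r \<in> ball x e"
      by (auto simp: dist_real_def)
    then have "b < f (of_rat r)"
      using e(2) by blast
    then show False
      using r by (simp add: not_le[symmetric])
  qed
qed auto

text \<open>
  A process on $[0,T]$ with continuous paths that is stopped at both ends has these properties.
  Working on the whole line means that increments never leave the time domain.
\<close>

locale bounded_uc_process = prob_space P for P :: "'w measure" +
  fixes X :: "real \<Rightarrow> 'w \<Rightarrow> real"
  assumes X_meas[measurable]: "\<And>t. X t \<in> borel_measurable P"
    and X_ucont: "\<And>\<omega>. \<omega> \<in> space P \<Longrightarrow> uniformly_continuous_on UNIV (\<lambda>t. X t \<omega>)"
    and X_bdd: "\<And>\<omega>. \<omega> \<in> space P \<Longrightarrow> \<exists>B. \<forall>t. \<bar>X t \<omega>\<bar> \<le> B"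
begin

lemma X_cont: "\<omega> \<in> space P \<Longrightarrow> continuous_on UNIV (\<lambda>t. X t \<omega>)"
  using X_ucont by (rule uniformly_continuous_imp_continuous)

text \<open>
  A continuous path is the limit of its values at dyadic times, and these depend measurably on the pair.
\<close>

lemma X_joint: "(\<lambda>x. X (fst x) (snd x)) \<in> borel_measurable (borel \<Otimes>\<^sub>M P)"
proof (rule borel_measurable_LIMSEQ_real)
  let ?u = "\<lambda>n::nat. \<lambda>t::real. real_of_int \<lfloor>t * 2 ^ n\<rfloor> / 2 ^ n"
  show "(\<lambda>n. X (?u n (fst x)) (snd x)) \<longlonglongrightarrow> X (fst x) (snd x)" if "x \<in> space (borel \<Otimes>\<^sub>M P)" for x
  proof (rule continuous_on_tendsto_compose[OF X_cont])
    show "snd x \<in> space P"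
      using that by (auto simp: space_pair_measure)
    show "(\<lambda>n. ?u n (fst x)) \<longlonglongrightarrow> fst x"
    proof (rule Lim_transform2[OF tendsto_const[of "fst x"]])
      have "\<bar>fst x - ?u n (fst x)\<bar> \<le> (1 / 2) ^ n" for n
      proof -
        have "fst x - ?u n (fst x) = (fst x * 2 ^ n - \<lfloor>fst x * 2 ^ n\<rfloor>) * (1 / 2) ^ n"
          by (simp add: field_simps)
        also have "\<bar>\<dots>\<bar> \<le> 1 * (1 / 2) ^ n"
          unfolding abs_mult by (intro mult_mono) (auto, linarith)
        finally show ?thesis by simp
      qed
      then show "(\<lambda>n. fst x - ?u n (fst x)) \<longlonglongrightarrow> 0"
        by (intro Lim_null_comparison[OF always_eventually LIMSEQ_power_zero[of "1 / 2"]]) auto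
    qed
  qed auto
  show "(\<lambda>x. X (?u n (fst x)) (snd x)) \<in> borel_measurable (borel \<Otimes>\<^sub>M P)" for n
    by (rule measurable_compose_countable[of "\<lambda>i x. X (real_of_int i / 2 ^ n) (snd x)" _ _ "\<lambda>x. \<lfloor>fst x * 2 ^ n\<rfloor>"])
       measurable
qed

lemma X_compose[measurable (raw)]:
  assumes "f \<in> borel_measurable M" "g \<in> measurable M P"
  shows "(\<lambda>x. X (f x) (g x)) \<in> borel_measurable M"
  using measurable_compose[OF measurable_Pair[OF assms] X_joint] by simp

definition paths_bounded_by :: "real \<Rightarrow> 'w set" where
  "paths_bounded_by B = {\<omega> \<in> space P. \<forall>t. \<bar>X t \<omega>\<bar> \<le> B}"

lemma paths_bounded_by_rat: "paths_bounded_by B = {\<omega> \<in> space P. \<forall>r::rat. \<bar>X (of_rat r) \<omega>\<bar> \<le> B}"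
proof -
  have "(\<forall>t. \<bar>X t \<omega>\<bar> \<le> B) \<longleftrightarrow> (\<forall>r::rat. \<bar>X (of_rat r) \<omega>\<bar> \<le> B)" if "\<omega> \<in> space P" for \<omega>
    by (intro continuous_le_iff_rat continuous_intros X_cont that)
  then show ?thesis
    by (auto simp: paths_bounded_by_def)
qed

lemma paths_bounded_by_events[measurable]: "paths_bounded_by B \<in> events"
  unfolding paths_bounded_by_rat by measurable

lemma prob_paths_bounded_by:
  assumes "\<tau> > 0"
  obtains B where "B > 0" "prob (paths_bounded_by B) > 1 - \<tau>"
proof -
  have "(\<lambda>n. prob (paths_bounded_by (real n))) \<longlonglongrightarrow> prob (\<Union>n. paths_bounded_by (real n))"
  proof (rule finite_Lim_measure_incseq)
    show "incseq (\<lambda>n. paths_bounded_by (real n))"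
      by (intro incseq_SucI) (auto simp: paths_bounded_by_def intro: add_increasing)
  qed auto
  moreover have "(\<Union>n. paths_bounded_by (real n)) = space P"
  proof safe
    fix \<omega> assume \<omega>: "\<omega> \<in> space P"
    obtain B where "\<forall>t. \<bar>X t \<omega>\<bar> \<le> B"
      using X_bdd[OF \<omega>] by auto
    then show "\<omega> \<in> (\<Union>n. paths_bounded_by (real n))"
      using \<omega> real_arch_simple[of B] unfolding paths_bounded_by_def by (blast intro: order.trans)
  qed (auto simp: paths_bounded_by_def)
  ultimately have "\<forall>\<^sub>F n in sequentially. 1 - \<tau> < prob (paths_bounded_by (real n))"
    using assms by (intro order_tendstoD(1)[of _ 1]) (auto simp: prob_space)
  then have "\<forall>\<^sub>F n in sequentially. 1 - \<tau> < prob (paths_bounded_by (real n)) \<and> real n > 0"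
    using eventually_gt_at_top[of 0] by eventually_elim auto
  then obtain n where "real n > 0" "prob (paths_bounded_by (real n)) > 1 - \<tau>"
    by (auto dest!: eventually_happens)
  then show ?thesis
    using that by blast
qed

end

section \<open>Random windows\<close>

text \<open>
  The contribution of one block to the signed sum: the value of $\phi$ at the drawn position, with
  the drawn sign, or 0 if the block is not used.
\<close>

definition signed_draw :: "(real \<Rightarrow> real) \<Rightarrow> real \<Rightarrow> real" where
  "signed_draw \<phi> t = (if 0 < \<bar>t\<bar> \<and> \<bar>t\<bar> < 1 then sgn t * \<phi> \<bar>t\<bar> else 0)"

lemma integral_PiM_coordinate:
  fixes f :: "'a \<Rightarrow> real"
  assumes "prob_space N" "i \<in> I" "f \<in> borel_measurable N"
  shows "(\<integral>\<theta>. f (\<theta> i) \<partial>PiM I (\<lambda>_. N)) = (\<integral>x. f x \<partial>N)"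
proof -
  have "(\<integral>x. f x \<partial>N) = (\<integral>x. f x \<partial>distr (PiM I (\<lambda>_. N)) N (\<lambda>\<theta>. \<theta> i))"
    using assms by (subst distr_PiM_component) auto
  also have "\<dots> = (\<integral>\<theta>. f (\<theta> i) \<partial>PiM I (\<lambda>_. N))"
    using assms by (subst integral_distr) auto
  finally show ?thesis ..
qed

text \<open>
  The random signs centre the summands, and the second moment of the sum is the total
  $\sum_k\int_0^1\phi_k^2$ divided by \<open>q\<close>.
\<close>

lemma random_signed_selection:
  fixes \<phi> :: "'i \<Rightarrow> real \<Rightarrow> real"
  assumes \<phi>[measurable]: "\<And>k. \<phi> k \<in> borel_measurable borel" and B: "\<And>k u. \<bar>\<phi> k u\<bar> \<le> B"
    and q: "q \<ge> 1" and I: "finite I" and v: "v > 0" "v \<ge> B\<^sup>2"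
    and large: "ennreal (v * q) \<le> (\<Sum>k\<in>I. \<integral>\<^sup>+u\<in>{0..<1}. ennreal ((\<phi> k u)\<^sup>2) \<partial>lborel)"
  shows "1 / 16 \<le> measure (PiM I (\<lambda>_. sym_unif q))
    {\<theta> \<in> space (PiM I (\<lambda>_. sym_unif q)). v / 2 \<le> (\<Sum>k\<in>I. signed_draw (\<phi> k) (\<theta> k))\<^sup>2}"
proof -
  let ?N = "sym_unif q" let ?Q = "PiM I (\<lambda>_. sym_unif q)"
  interpret N: prob_space ?N
    using q by (intro prob_space_sym_unif) simp
  interpret Q: prob_space ?Q
    by (rule prob_space_PiM) unfold_locales
  have B0: "B \<ge> 0"
    using B[of undefined undefined] by simp
  have meas[measurable]: "signed_draw (\<phi> k) \<in> borel_measurable borel" for k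
    unfolding signed_draw_def by measurable
  have bnd: "\<bar>signed_draw (\<phi> k) t\<bar> \<le> B" for k t
    using B[of k "\<bar>t\<bar>"] B0 by (auto simp: signed_draw_def abs_mult sgn_if)
  have sq: "(\<integral>\<^sup>+t. ennreal ((signed_draw (\<phi> k) t)\<^sup>2) \<partial>?N) = (\<integral>\<^sup>+u\<in>{0..<1}. ennreal ((\<phi> k u)\<^sup>2) \<partial>lborel) / ennreal q" for k
  proof -
    have "(\<integral>\<^sup>+t. ennreal ((signed_draw (\<phi> k) t)\<^sup>2) \<partial>?N)
        = (\<integral>\<^sup>+t. ennreal ((\<phi> k \<bar>t\<bar>)\<^sup>2) * indicator {t. 0 < \<bar>t\<bar> \<and> \<bar>t\<bar> < 1} t \<partial>?N)"
      by (intro nn_integral_cong) (auto simp: signed_draw_def power_mult_distrib sgn_if split: split_indicator)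
    also have "\<dots> = (\<integral>\<^sup>+u\<in>{0..<1}. ennreal ((\<phi> k u)\<^sup>2) \<partial>lborel) / ennreal q"
      using q by (subst nn_integral_sym_unif_even) auto
    finally show ?thesis .
  qed
  have int: "integrable ?N (\<lambda>t. (signed_draw (\<phi> k) t)\<^sup>2)" for k
  proof (rule N.integrable_const_bound[where B = "B\<^sup>2"])
    show "AE t in ?N. norm ((signed_draw (\<phi> k) t)\<^sup>2) \<le> B\<^sup>2"
      using bnd[of k] power_mono[OF bnd[of k], of _ 2] by auto
  qed auto
  have "ennreal v = ennreal (v * q) / ennreal q"
    using q v by (simp add: divide_ennreal)
  also have "\<dots> \<le> (\<Sum>k\<in>I. \<integral>\<^sup>+u\<in>{0..<1}. ennreal ((\<phi> k u)\<^sup>2) \<partial>lborel) / ennreal q"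
    by (rule divide_right_mono_ennreal) (rule large)
  also have "\<dots> = (\<Sum>k\<in>I. \<integral>\<^sup>+t. ennreal ((signed_draw (\<phi> k) t)\<^sup>2) \<partial>?N)"
    by (simp add: sq divide_ennreal_def sum_distrib_right)
  also have "\<dots> = ennreal (\<Sum>k\<in>I. \<integral>t. (signed_draw (\<phi> k) t)\<^sup>2 \<partial>?N)"
    using int by (subst sum_ennreal[symmetric]) (auto simp: nn_integral_eq_integral)
  finally have "v \<le> (\<Sum>k\<in>I. \<integral>t. (signed_draw (\<phi> k) t)\<^sup>2 \<partial>?N)"
    by (subst (asm) ennreal_le_iff) (auto intro!: sum_nonneg)
  then have vle: "v \<le> (\<Sum>k\<in>I. \<integral>\<theta>. (signed_draw (\<phi> k) (\<theta> k))\<^sup>2 \<partial>?Q)"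
    using N.prob_space_axioms by (simp add: integral_PiM_coordinate[where f = "\<lambda>t. (signed_draw (\<phi> _) t)\<^sup>2"] cong: sum.cong)
  have odd: "(\<integral>t. signed_draw (\<phi> k) t \<partial>?N) = 0" for k
    using q by (intro integral_sym_unif_odd) (auto simp: signed_draw_def)
  show ?thesis
  proof (rule Q.anticoncentration_of_centred_indep_sum[OF I, where B = B])
    show "Q.indep_vars (\<lambda>_. borel) (\<lambda>k \<theta>. signed_draw (\<phi> k) (\<theta> k)) I"
      using I N.prob_space_axioms by (intro indep_vars_coordinates) auto
    show "Q.expectation (\<lambda>\<theta>. signed_draw (\<phi> k) (\<theta> k)) = 0" if "k \<in> I" for k
      using that N.prob_space_axioms odd[of k] by (subst integral_PiM_coordinate) auto
  qed (use bnd vle v in auto)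
qed

text \<open>
  The window drawn in block \<open>k\<close> stays inside an interval of length $2\varepsilon$, and these intervals are
  disjoint; so a point can be covered only by the window of its own block, which exists with probability $1/q$.
\<close>

lemma random_windows_cover_rarely:
  fixes c \<epsilon> s q :: real
  assumes q: "q \<ge> 1" and \<epsilon>: "\<epsilon> > 0"
  shows "emeasure (PiM {..<n} (\<lambda>_. sym_unif q)) {\<theta> \<in> space (PiM {..<n} (\<lambda>_. sym_unif q)).
      \<exists>k<n. 0 < \<bar>\<theta> k\<bar> \<and> \<bar>\<theta> k\<bar> < 1 \<and> c + 2 * real k * \<epsilon> + \<epsilon> * \<bar>\<theta> k\<bar> < s
        \<and> s \<le> c + 2 * real k * \<epsilon> + \<epsilon> * \<bar>\<theta> k\<bar> + \<epsilon>} \<le> ennreal (1 / q)"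
    (is "emeasure ?Q ?E \<le> _")
proof (cases "\<exists>k<n. c + 2 * real k * \<epsilon> < s \<and> s < c + 2 * real k * \<epsilon> + 2 * \<epsilon>")
  case False
  have "?E = {}"
  proof safe
    fix \<theta> :: "nat \<Rightarrow> real" and k :: nat
    assume k: "k < n" and \<theta>: "0 < \<bar>\<theta> k\<bar>" "\<bar>\<theta> k\<bar> < 1" "c + 2 * real k * \<epsilon> + \<epsilon> * \<bar>\<theta> k\<bar> < s"
      "s \<le> c + 2 * real k * \<epsilon> + \<epsilon> * \<bar>\<theta> k\<bar> + \<epsilon>"
    have "0 < \<epsilon> * \<bar>\<theta> k\<bar>" "\<epsilon> * \<bar>\<theta> k\<bar> < \<epsilon> * 1"
      using \<theta> \<epsilon> by (auto intro!: mult_strict_left_mono simp: zero_less_mult_iff)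
    then have "c + 2 * real k * \<epsilon> < s" "s < c + 2 * real k * \<epsilon> + 2 * \<epsilon>"
      using \<theta> by linarith+
    then show "\<theta> \<in> {}"
      using False k by blast
  qed
  then show ?thesis
    unfolding \<open>?E = {}\<close> by simp
next
  case True
  then obtain k where k: "k < n" "c + 2 * real k * \<epsilon> < s" "s < c + 2 * real k * \<epsilon> + 2 * \<epsilon>"
    by auto
  have P: "prob_space (sym_unif q)"
    using q by (intro prob_space_sym_unif) simp
  have "?E \<subseteq> {\<theta> \<in> space ?Q. 0 < \<bar>\<theta> k\<bar> \<and> \<bar>\<theta> k\<bar> < 1}"
  proof safe
    fix \<theta> :: "nat \<Rightarrow> real" and l :: nat
    assume l: "l < n" and \<theta>: "0 < \<bar>\<theta> l\<bar>" "\<bar>\<theta> l\<bar> < 1" "c + 2 * real l * \<epsilon> + \<epsilon> * \<bar>\<theta> l\<bar> < s"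
      "s \<le> c + 2 * real l * \<epsilon> + \<epsilon> * \<bar>\<theta> l\<bar> + \<epsilon>"
    have "0 < \<epsilon> * \<bar>\<theta> l\<bar>" "\<epsilon> * \<bar>\<theta> l\<bar> < \<epsilon> * 1"
      using \<theta> \<epsilon> by (auto intro!: mult_strict_left_mono simp: zero_less_mult_iff)
    then have "2 * real l * \<epsilon> < 2 * real k * \<epsilon> + 2 * \<epsilon>" "2 * real k * \<epsilon> < 2 * real l * \<epsilon> + 2 * \<epsilon>"
      using \<theta> k by linarith+
    then have "2 * \<epsilon> * real l < 2 * \<epsilon> * (real k + 1)" "2 * \<epsilon> * real k < 2 * \<epsilon> * (real l + 1)"
      by (simp_all add: algebra_simps)
    then have "real l < real k + 1" "real k < real l + 1"
      using \<epsilon> by (simp_all only: mult_less_cancel_left_pos)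
    then have "l = k" by linarith
    then show "0 < \<bar>\<theta> k\<bar>" "\<bar>\<theta> k\<bar> < 1"
      using \<theta> by auto
  qed
  then have "emeasure ?Q ?E \<le> emeasure ?Q {\<theta> \<in> space ?Q. 0 < \<bar>\<theta> k\<bar> \<and> \<bar>\<theta> k\<bar> < 1}"
    using k by (intro emeasure_mono) auto
  also have "\<dots> = emeasure (distr ?Q (sym_unif q) (\<lambda>\<theta>. \<theta> k)) {t. 0 < \<bar>t\<bar> \<and> \<bar>t\<bar> < 1}"
    using k by (subst emeasure_distr) (auto intro!: arg_cong2[where f = emeasure])
  also have "\<dots> = emeasure (sym_unif q) {t. 0 < \<bar>t\<bar> \<and> \<bar>t\<bar> < 1}"
    using k P by (subst distr_PiM_component) auto
  also have "\<dots> = (\<integral>\<^sup>+t. 1 * indicator {t. 0 < \<bar>t\<bar> \<and> \<bar>t\<bar> < 1} t \<partial>sym_unif q)"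
    by simp
  also have "\<dots> = ennreal (1 / q)"
    using q by (subst nn_integral_sym_unif_even) (auto simp: divide_ennreal_def inverse_ennreal inverse_eq_divide)
  finally show ?thesis .
qed

lemma nn_integral_rescale_block:
  fixes g :: "real \<Rightarrow> ennreal"
  assumes [measurable]: "g \<in> borel_measurable borel" and \<epsilon>: "\<epsilon> > 0"
  shows "(\<integral>\<^sup>+s\<in>{b..<b + \<epsilon>}. g s \<partial>lborel) = (\<integral>\<^sup>+u\<in>{0..<1}. ennreal \<epsilon> * g (b + \<epsilon> * u) \<partial>lborel)"
proof -
  have "(\<integral>\<^sup>+s\<in>{b..<b + \<epsilon>}. g s \<partial>lborel)
      = ennreal \<bar>\<epsilon>\<bar> * (\<integral>\<^sup>+u. g (b + \<epsilon> * u) * indicator {b..<b + \<epsilon>} (b + \<epsilon> * u) \<partial>lborel)"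
    using \<epsilon> by (subst nn_integral_real_affine[where c = \<epsilon> and t = b]) auto
  also have "\<dots> = (\<integral>\<^sup>+u. ennreal \<epsilon> * (g (b + \<epsilon> * u) * indicator {b..<b + \<epsilon>} (b + \<epsilon> * u)) \<partial>lborel)"
    using \<epsilon> by (subst nn_integral_cmult) auto
  also have "\<dots> = (\<integral>\<^sup>+u\<in>{0..<1}. ennreal \<epsilon> * g (b + \<epsilon> * u) \<partial>lborel)"
    using \<epsilon> by (intro nn_integral_cong) (auto split: split_indicator simp: mult_less_cancel_left2 zero_le_mult_iff)
  finally show ?thesis .
qed

text \<open>
  A window that starts in a block of length $\varepsilon$ may end in the next one. Treating the blocks
  of even and odd number separately keeps windows from different blocks apart.
\<close>

lemma nn_integral_even_odd_blocks:
  fixes g :: "real \<Rightarrow> ennreal"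
  assumes g[measurable]: "g \<in> borel_measurable borel" and \<epsilon>: "\<epsilon> > 0"
  shows "(\<integral>\<^sup>+s\<in>{0..<2 * real n * \<epsilon>}. g s \<partial>lborel)
    = (\<Sum>k<n. \<integral>\<^sup>+u\<in>{0..<1}. ennreal \<epsilon> * g (0 + 2 * real k * \<epsilon> + \<epsilon> * u) \<partial>lborel)
    + (\<Sum>k<n. \<integral>\<^sup>+u\<in>{0..<1}. ennreal \<epsilon> * g (\<epsilon> + 2 * real k * \<epsilon> + \<epsilon> * u) \<partial>lborel)"
proof (induction n)
  case (Suc n)
  have "(\<integral>\<^sup>+s\<in>{0..<2 * real (Suc n) * \<epsilon>}. g s \<partial>lborel)
      = (\<integral>\<^sup>+s. g s * indicator {0..<2 * real n * \<epsilon>} s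
        + (g s * indicator {0 + 2 * real n * \<epsilon>..<0 + 2 * real n * \<epsilon> + \<epsilon>} s
        + g s * indicator {\<epsilon> + 2 * real n * \<epsilon>..<\<epsilon> + 2 * real n * \<epsilon> + \<epsilon>} s) \<partial>lborel)"
  proof (rule nn_integral_cong)
    fix s :: real
    define d where "d = 2 * real n * \<epsilon>"
    have "0 \<le> d" "2 * real (Suc n) * \<epsilon> = d + 2 * \<epsilon>"
      using \<epsilon> by (simp_all add: d_def algebra_simps)
    then show "g s * indicator {0..<2 * real (Suc n) * \<epsilon>} s = g s * indicator {0..<2 * real n * \<epsilon>} s
        + (g s * indicator {0 + 2 * real n * \<epsilon>..<0 + 2 * real n * \<epsilon> + \<epsilon>} s
        + g s * indicator {\<epsilon> + 2 * real n * \<epsilon>..<\<epsilon> + 2 * real n * \<epsilon> + \<epsilon>} s)"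
      unfolding d_def[symmetric] using \<epsilon> by (auto split: split_indicator)
  qed
  also have "\<dots> = (\<integral>\<^sup>+s\<in>{0..<2 * real n * \<epsilon>}. g s \<partial>lborel)
      + ((\<integral>\<^sup>+s\<in>{0 + 2 * real n * \<epsilon>..<0 + 2 * real n * \<epsilon> + \<epsilon>}. g s \<partial>lborel)
      + (\<integral>\<^sup>+s\<in>{\<epsilon> + 2 * real n * \<epsilon>..<\<epsilon> + 2 * real n * \<epsilon> + \<epsilon>}. g s \<partial>lborel))"
    by (simp add: nn_integral_add del: add_0)
  finally show ?case
    unfolding nn_integral_rescale_block[OF g \<epsilon>] Suc.IH sum.lessThan_Suc by (simp only: add_ac)
qed simp

section \<open>Quadratic energy of a process\<close>

text \<open>
  A finite union of half-open intervals with end points in \<open>Z\<close>, described so that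
  differences and unions are immediate: membership can change only when a point of \<open>Z\<close> is passed,
  and such a point still belongs to the interval on its left.
\<close>

definition cellular :: "real set \<Rightarrow> real set \<Rightarrow> bool" where
  "cellular Z F \<longleftrightarrow> (\<forall>x y. x \<le> y \<longrightarrow> Z \<inter> {x..<y} = {} \<longrightarrow> (x \<in> F \<longleftrightarrow> y \<in> F))"

lemma cellular_interval: "cellular {a, b} {a<..b}"
  by (auto simp: cellular_def)

lemma cellular_Diff:
  assumes "cellular Z F" "cellular Z' F'"
  shows "cellular (Z \<union> Z') (F - F')"
  unfolding cellular_def
proof (intro allI impI)
  fix x y :: real
  assume "x \<le> y" "(Z \<union> Z') \<inter> {x..<y} = {}"
  then have "x \<in> F \<longleftrightarrow> y \<in> F" "x \<in> F' \<longleftrightarrow> y \<in> F'"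
    using assms by (auto simp: cellular_def Int_Un_distrib2)
  then show "x \<in> F - F' \<longleftrightarrow> y \<in> F - F'"
    by simp
qed

lemma cellular_UN:
  assumes "\<And>k. k \<in> A \<Longrightarrow> cellular (Z k) (F k)"
  shows "cellular (\<Union>k\<in>A. Z k) (\<Union>k\<in>A. F k)"
  unfolding cellular_def
proof (intro allI impI)
  fix x y :: real
  assume xy: "x \<le> y" "(\<Union>k\<in>A. Z k) \<inter> {x..<y} = {}"
  have "x \<in> F k \<longleftrightarrow> y \<in> F k" if "k \<in> A" for k
  proof -
    have "Z k \<inter> {x..<y} = {}"
      using xy(2) that by blast
    then show ?thesis
      using assms[OF that] xy(1) by (simp add: cellular_def)
  qed
  then show "x \<in> (\<Union>k\<in>A. F k) \<longleftrightarrow> y \<in> (\<Union>k\<in>A. F k)"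
    by auto
qed

text \<open>
  The starts \<open>s\<close> whose window $(s,s+\varepsilon]$ is not cut by an end point of \<open>F\<close>. All other starts lie within
  $\varepsilon$ to the left of a point of \<open>Z\<close>, so they carry a bounded part of the energy only.
\<close>

definition good_starts :: "real set \<Rightarrow> real \<Rightarrow> real set \<Rightarrow> real set" where
  "good_starts Z \<epsilon> F = {s \<in> F. Z \<inter> {s..<s + \<epsilon>} = {}}"

lemma good_starts_window:
  assumes "cellular Z F" "s \<in> good_starts Z \<epsilon> F"
  shows "{s<..s + \<epsilon>} \<subseteq> F"
proof
  fix y assume y: "y \<in> {s<..s + \<epsilon>}"
  then have "Z \<inter> {s..<y} = {}"
    using assms(2) by (auto simp: good_starts_def)
  then show "y \<in> F"
    using assms y unfolding cellular_def good_starts_def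
    by (metis (no_types, lifting) greaterThanAtMost_iff less_imp_le mem_Collect_eq)
qed

lemma bad_starts_subset: "F - good_starts Z \<epsilon> F \<subseteq> (\<Union>z\<in>Z. {z - \<epsilon><..z})"
  by (auto simp: good_starts_def)

lemma good_starts_borel:
  assumes "finite Z" "F \<in> sets borel"
  shows "good_starts Z \<epsilon> F \<in> sets borel"
proof -
  have "good_starts Z \<epsilon> F = F - (\<Union>z\<in>Z. {z - \<epsilon><..z})"
    by (auto simp: good_starts_def)
  moreover have "(\<Union>z\<in>Z. {z - \<epsilon><..z}) \<in> sets borel"
    using assms(1) by (intro sets.finite_UN) auto
  ultimately show ?thesis
    using assms(2) by simp
qed

context bounded_uc_process
begin

text \<open>
  With values in the extended nonnegative reals, so that additivity in \<open>F\<close> and Tonelli's theorem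
  hold without integrability conditions.
\<close>

definition energy :: "real set \<Rightarrow> real \<Rightarrow> 'w \<Rightarrow> ennreal" where
  "energy F \<epsilon> \<omega> = (\<integral>\<^sup>+s\<in>F. ennreal ((X (s + \<epsilon>) \<omega> - X s \<omega>)\<^sup>2 / \<epsilon>) \<partial>lborel)"

lemma energy_measurable[measurable]:
  assumes [measurable]: "F \<in> sets borel"
  shows "energy F \<epsilon> \<in> borel_measurable P"
  unfolding energy_def by measurable

lemma energy_Diff:
  assumes [measurable]: "F \<in> sets borel" "R \<in> sets borel" and "R \<subseteq> F" "\<omega> \<in> space P"
  shows "energy F \<epsilon> \<omega> = energy R \<epsilon> \<omega> + energy (F - R) \<epsilon> \<omega>"
proof -
  have [measurable]: "(\<lambda>s. X (s + \<epsilon>) \<omega>) \<in> borel_measurable borel" "(\<lambda>s. X s \<omega>) \<in> borel_measurable borel"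
    using assms by measurable
  show ?thesis
    unfolding energy_def
    by (subst nn_integral_add[symmetric])
       (use assms(3) in \<open>auto intro!: nn_integral_cong split: split_indicator\<close>)
qed

lemma energy_mono: "R \<subseteq> F \<Longrightarrow> energy R \<epsilon> \<omega> \<le> energy F \<epsilon> \<omega>"
  unfolding energy_def by (intro nn_integral_mono) (auto split: split_indicator)

lemma increment_bound:
  assumes "\<omega> \<in> paths_bounded_by B"
  shows "\<bar>X t \<omega> - X s \<omega>\<bar> \<le> 2 * B"
proof -
  have "\<bar>X t \<omega>\<bar> \<le> B" "\<bar>X s \<omega>\<bar> \<le> B"
    using assms by (auto simp: paths_bounded_by_def)
  then show ?thesis
    by linarith
qed

lemma energy_bound:
  assumes "\<omega> \<in> paths_bounded_by B" "\<epsilon> > 0" "F \<in> sets borel"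
  shows "energy F \<epsilon> \<omega> \<le> ennreal (4 * B\<^sup>2 / \<epsilon>) * emeasure lborel F"
proof -
  have "(X (s + \<epsilon>) \<omega> - X s \<omega>)\<^sup>2 \<le> 4 * B\<^sup>2" for s
    using power_mono[OF increment_bound[OF assms(1), of "s + \<epsilon>" s], of 2] by (simp add: power_mult_distrib)
  then have "energy F \<epsilon> \<omega> \<le> (\<integral>\<^sup>+s. ennreal (4 * B\<^sup>2 / \<epsilon>) * indicator F s \<partial>lborel)"
    unfolding energy_def using assms(2)
    by (intro nn_integral_mono mult_right_mono ennreal_leI divide_right_mono) auto
  then show ?thesis
    using assms by (simp add: nn_integral_cmult_indicator)
qed

lemma energy_finite:
  assumes "\<omega> \<in> space P" "\<epsilon> > 0" "F \<in> sets borel" "F \<subseteq> {0<..T}"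
  shows "energy F \<epsilon> \<omega> < \<top>"
proof -
  obtain B where "\<omega> \<in> paths_bounded_by B"
    using X_bdd[OF assms(1)] assms(1) by (auto simp: paths_bounded_by_def)
  then have "energy F \<epsilon> \<omega> \<le> ennreal (4 * B\<^sup>2 / \<epsilon>) * emeasure lborel F"
    using assms by (intro energy_bound)
  also have "emeasure lborel F \<le> emeasure lborel {0<..T}"
    using assms by (intro emeasure_mono) auto
  also have "ennreal (4 * B\<^sup>2 / \<epsilon>) * emeasure lborel {0<..T} < \<top>"
    by (cases "0 \<le> T") (simp_all add: ennreal_mult_less_top)
  finally show ?thesis
    by (auto simp: mult_left_mono)
qed

text \<open>
  The bad starts have measure at most $\varepsilon$ times the number of end points, and the
  integrand is at most $4B^2/\varepsilon$; the loss is independent of $\varepsilon$.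
\<close>

lemma energy_le_good_starts:
  assumes "\<omega> \<in> paths_bounded_by B" "\<epsilon> > 0" "F \<in> sets borel" "finite Z"
  shows "energy F \<epsilon> \<omega> \<le> energy (good_starts Z \<epsilon> F) \<epsilon> \<omega> + ennreal (real (card Z) * (4 * B\<^sup>2))"
proof -
  have G[measurable]: "good_starts Z \<epsilon> F \<in> sets borel"
    using assms by (intro good_starts_borel)
  have "emeasure lborel (\<Union>z\<in>Z. {z - \<epsilon><..z}) \<le> (\<Sum>z\<in>Z. emeasure lborel {z - \<epsilon><..z})"
    using assms by (intro emeasure_subadditive_finite) auto
  also have "\<dots> = ennreal (real (card Z) * \<epsilon>)"
    using assms by (simp add: ennreal_mult ennreal_of_nat_eq_real_of_nat)
  finally have vol: "emeasure lborel (\<Union>z\<in>Z. {z - \<epsilon><..z}) \<le> ennreal (real (card Z) * \<epsilon>)" .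
  have "energy (F - good_starts Z \<epsilon> F) \<epsilon> \<omega> \<le> energy (\<Union>z\<in>Z. {z - \<epsilon><..z}) \<epsilon> \<omega>"
    by (intro energy_mono bad_starts_subset)
  also have "\<dots> \<le> ennreal (4 * B\<^sup>2 / \<epsilon>) * emeasure lborel (\<Union>z\<in>Z. {z - \<epsilon><..z})"
    using assms by (intro energy_bound) auto
  also have "\<dots> \<le> ennreal (4 * B\<^sup>2 / \<epsilon>) * ennreal (real (card Z) * \<epsilon>)"
    by (intro mult_left_mono vol) simp
  also have "\<dots> = ennreal (real (card Z) * (4 * B\<^sup>2))"
    using assms by (subst ennreal_mult[symmetric]) auto
  finally have "energy (F - good_starts Z \<epsilon> F) \<epsilon> \<omega> \<le> ennreal (real (card Z) * (4 * B\<^sup>2))" .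
  moreover have "energy F \<epsilon> \<omega> = energy (good_starts Z \<epsilon> F) \<epsilon> \<omega> + energy (F - good_starts Z \<epsilon> F) \<epsilon> \<omega>"
    using assms by (intro energy_Diff) (auto simp: paths_bounded_by_def G, auto simp: good_starts_def)
  ultimately show ?thesis
    by (simp add: add_left_mono)
qed

text \<open>
  The family of energies on \<open>F\<close> is not bounded in probability as $\varepsilon\to 0$, and this
  is witnessed with probability more than \<open>a\<close>. Keeping track of \<open>a\<close> makes it possible to remove
  infinitely many sets and lose only half of it.
\<close>

definition energy_unbounded :: "real set \<Rightarrow> real \<Rightarrow> bool" where
  "energy_unbounded F a \<longleftrightarrow>
    (\<forall>K. \<forall>\<epsilon>0>0. \<exists>\<epsilon>>0. \<epsilon> < \<epsilon>0 \<and> a < prob {\<omega> \<in> space P. ennreal K < energy F \<epsilon> \<omega>})"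

text \<open>
  In block \<open>k\<close> the starts run through $c + 2k\varepsilon + \varepsilon u$ with $0\le u<1$, where \<open>c\<close> is 0 for the even
  and $\varepsilon$ for the odd half-blocks.
\<close>

definition window_incr :: "real set \<Rightarrow> real \<Rightarrow> real \<Rightarrow> nat \<Rightarrow> real \<Rightarrow> 'w \<Rightarrow> real" where
  "window_incr G \<epsilon> c k u \<omega> = indicator G (c + 2 * real k * \<epsilon> + \<epsilon> * u)
     * (X (c + 2 * real k * \<epsilon> + \<epsilon> * u + \<epsilon>) \<omega> - X (c + 2 * real k * \<epsilon> + \<epsilon> * u) \<omega>)"

lemma window_incr_measurable[measurable (raw)]:
  assumes [measurable]: "G \<in> sets borel" "f \<in> borel_measurable M" "g \<in> measurable M P"
  shows "(\<lambda>x. window_incr G \<epsilon> c k (f x) (g x)) \<in> borel_measurable M"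
  unfolding window_incr_def by measurable

lemma energy_blocks:
  assumes G[measurable]: "G \<in> sets borel" and sub: "G \<subseteq> {0..<2 * real n * \<epsilon>}" and \<epsilon>: "\<epsilon> > 0"
    and \<omega>[measurable]: "\<omega> \<in> space P"
  shows "energy G \<epsilon> \<omega> = (\<Sum>k<n. \<integral>\<^sup>+u\<in>{0..<1}. ennreal ((window_incr G \<epsilon> 0 k u \<omega>)\<^sup>2) \<partial>lborel)
    + (\<Sum>k<n. \<integral>\<^sup>+u\<in>{0..<1}. ennreal ((window_incr G \<epsilon> \<epsilon> k u \<omega>)\<^sup>2) \<partial>lborel)"
proof -
  define g where "g s = ennreal ((X (s + \<epsilon>) \<omega> - X s \<omega>)\<^sup>2 / \<epsilon>) * indicator G s" for s
  have [measurable]: "g \<in> borel_measurable borel"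
    unfolding g_def by measurable
  have sq: "ennreal \<epsilon> * g (c + 2 * real k * \<epsilon> + \<epsilon> * u) = ennreal ((window_incr G \<epsilon> c k u \<omega>)\<^sup>2)" for c k u
    unfolding g_def window_incr_def using \<epsilon>
    by (auto split: split_indicator simp: ennreal_mult[symmetric] simp flip: mult.assoc)
  have "energy G \<epsilon> \<omega> = (\<integral>\<^sup>+s\<in>{0..<2 * real n * \<epsilon>}. g s \<partial>lborel)"
    unfolding energy_def g_def using sub by (intro nn_integral_cong) (auto split: split_indicator)
  also note nn_integral_even_odd_blocks[OF \<open>g \<in> borel_measurable borel\<close> \<epsilon>]
  finally show ?thesis
    by (simp only: sq)
qed

end

section \<open>Energy in blocks and energy caught by random windows\<close>

context bounded_uc_process
begin

text \<open>
  On a path bounded by \<open>B\<close>, discarding the bad starts costs a fixed amount and the better of the two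
  parities keeps half of the energy; so a large energy on \<open>F\<close> leaves the amount $v q$ in one of the two families
  of blocks. The bounds on \<open>v\<close> are those which make the variance dominate the squared size of the
  increments and the signed sum reach 2.
\<close>

lemma large_energy_in_blocks:
  assumes unb: "energy_unbounded F a" and F[measurable]: "F \<in> sets borel" "F \<subseteq> {0<..T}"
    and Z: "finite Z" and a: "a > 0" and q: "q \<ge> 1"
  obtains \<epsilon> c B v :: real and n :: nat
  where "\<epsilon> > 0" "B > 0" "v \<ge> 8" "v \<ge> (2 * B)\<^sup>2"
    "a / 4 \<le> prob {\<omega> \<in> paths_bounded_by B. ennreal (v * q) \<le>
        (\<Sum>k<n. \<integral>\<^sup>+u\<in>{0..<1}. ennreal ((window_incr (good_starts Z \<epsilon> F) \<epsilon> c k u \<omega>)\<^sup>2) \<partial>lborel)}"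
proof -
  obtain B where B: "B > 0" "prob (paths_bounded_by B) > 1 - a / 2"
    using prob_paths_bounded_by[of "a / 2"] a by auto
  define v where "v = max 8 ((2 * B)\<^sup>2)"
  define b where "b = real (card Z) * (4 * B\<^sup>2)"
  have v: "v \<ge> 8" "v \<ge> (2 * B)\<^sup>2" and b: "b \<ge> 0"
    by (auto simp: v_def b_def)
  obtain \<epsilon> where \<epsilon>: "\<epsilon> > 0"
    and prob: "a < prob {\<omega> \<in> space P. ennreal (2 * v * q + b) < energy F \<epsilon> \<omega>}"
    using unb zero_less_one unfolding energy_unbounded_def by blast
  define G where "G = good_starts Z \<epsilon> F"
  have G[measurable]: "G \<in> sets borel"
    unfolding G_def using Z F by (intro good_starts_borel)
  obtain n :: nat where n: "T / (2 * \<epsilon>) < real n"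
    using reals_Archimedean2 by blast
  then have sub: "G \<subseteq> {0..<2 * real n * \<epsilon>}"
    using F \<epsilon> by (auto simp: G_def good_starts_def field_simps dest!: subsetD)
  define S where "S c \<omega> = (\<Sum>k<n. \<integral>\<^sup>+u\<in>{0..<1}. ennreal ((window_incr G \<epsilon> c k u \<omega>)\<^sup>2) \<partial>lborel)" for c \<omega>
  have [measurable]: "S c \<in> borel_measurable P" for c
    unfolding S_def by measurable
  define D where "D c = {\<omega> \<in> paths_bounded_by B. ennreal (v * q) \<le> S c \<omega>}" for c
  have D_eq: "D c = paths_bounded_by B \<inter> {\<omega> \<in> space P. ennreal (v * q) \<le> S c \<omega>}" for c
    by (auto simp: D_def paths_bounded_by_def)
  have [measurable]: "D c \<in> events" for c
    unfolding D_eq by measurable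
  let ?A = "{\<omega> \<in> space P. ennreal (2 * v * q + b) < energy F \<epsilon> \<omega>}"
  have "?A \<subseteq> (space P - paths_bounded_by B) \<union> (D 0 \<union> D \<epsilon>)"
  proof
    fix \<omega> assume \<omega>: "\<omega> \<in> ?A"
    show "\<omega> \<in> (space P - paths_bounded_by B) \<union> (D 0 \<union> D \<epsilon>)"
    proof (cases "\<omega> \<in> paths_bounded_by B")
      case True
      have "ennreal (2 * v * q) + ennreal b < energy F \<epsilon> \<omega>"
        using \<omega> v q b by (subst ennreal_plus[symmetric]) auto
      also have "\<dots> \<le> energy G \<epsilon> \<omega> + ennreal b"
        using energy_le_good_starts[OF True \<epsilon> F(1) Z] by (simp add: G_def b_def)
      finally have "ennreal (2 * v * q) < energy G \<epsilon> \<omega>"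
        by (metis add_right_mono leI not_le)
      also have "\<dots> = S 0 \<omega> + S \<epsilon> \<omega>"
        unfolding S_def using \<omega> by (intro energy_blocks G sub \<epsilon>) auto
      finally have large: "ennreal (2 * v * q) < S 0 \<omega> + S \<epsilon> \<omega>" .
      have "ennreal (v * q) \<le> S 0 \<omega> \<or> ennreal (v * q) \<le> S \<epsilon> \<omega>"
      proof (rule ccontr)
        assume "\<not> ?thesis"
        then have "S 0 \<omega> + S \<epsilon> \<omega> \<le> ennreal (v * q) + ennreal (v * q)"
          by (intro add_mono) auto
        also have "\<dots> = ennreal (2 * v * q)"
          using v q by (subst ennreal_plus[symmetric]) auto
        finally show False
          using large by simp
      qed
      then show ?thesis
        using True by (auto simp: D_def)
    qed (use \<omega> in auto)
  qed
  then have "prob ?A \<le> prob ((space P - paths_bounded_by B) \<union> (D 0 \<union> D \<epsilon>))"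
    by (intro finite_measure_mono) auto
  also have "\<dots> \<le> prob (space P - paths_bounded_by B) + (prob (D 0) + prob (D \<epsilon>))"
    by (intro order.trans[OF measure_Un_le] add_left_mono measure_Un_le) auto
  finally have "a / 2 < prob (D 0) + prob (D \<epsilon>)"
    using prob B by (simp add: prob_compl)
  then have "a / 4 \<le> prob (D 0) \<or> a / 4 \<le> prob (D \<epsilon>)"
    by linarith
  then obtain c where "a / 4 \<le> prob (D c)"
    by blast
  then show ?thesis
    using that[of \<epsilon> B v c n] \<epsilon> B v unfolding D_def S_def G_def by simp
qed

definition window_start :: "real \<Rightarrow> real \<Rightarrow> (nat \<Rightarrow> real) \<Rightarrow> nat \<Rightarrow> real" where
  "window_start c \<epsilon> \<theta> k = c + 2 * real k * \<epsilon> + \<epsilon> * \<bar>\<theta> k\<bar>"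

text \<open>
  Windows that would leave \<open>F\<close> are dropped by letting \<open>G\<close> be the set of good starts.
\<close>

definition chosen_windows :: "real set \<Rightarrow> real \<Rightarrow> real \<Rightarrow> nat \<Rightarrow> (nat \<Rightarrow> real) \<Rightarrow> nat set" where
  "chosen_windows G c \<epsilon> n \<theta> = {k. k < n \<and> 0 < \<bar>\<theta> k\<bar> \<and> \<bar>\<theta> k\<bar> < 1 \<and> window_start c \<epsilon> \<theta> k \<in> G}"

lemma chosen_windows_ordered:
  assumes "\<epsilon> > 0" "k \<in> chosen_windows G c \<epsilon> n \<theta>" "l \<in> chosen_windows G c \<epsilon> n \<theta>" "k < l"
  shows "window_start c \<epsilon> \<theta> k + \<epsilon> \<le> window_start c \<epsilon> \<theta> l"
proof -
  have "\<epsilon> * \<bar>\<theta> k\<bar> \<le> \<epsilon> * 1" "0 \<le> \<epsilon> * \<bar>\<theta> l\<bar>"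
    using assms by (auto simp: chosen_windows_def intro!: mult_left_mono)
  moreover have "\<epsilon> * (real k + 1) \<le> \<epsilon> * real l"
    using assms by (intro mult_left_mono) auto
  ultimately show ?thesis
    by (simp add: window_start_def algebra_simps)
qed

lemma chosen_windows_disjoint:
  assumes "\<epsilon> > 0"
  shows "disjoint_family_on (\<lambda>k. {window_start c \<epsilon> \<theta> k<..window_start c \<epsilon> \<theta> k + \<epsilon>}) (chosen_windows G c \<epsilon> n \<theta>)"
  unfolding disjoint_family_on_def
proof (intro ballI impI)
  fix k l assume kl: "k \<in> chosen_windows G c \<epsilon> n \<theta>" "l \<in> chosen_windows G c \<epsilon> n \<theta>" "k \<noteq> l"
  then consider "k < l" | "l < k"
    by linarith
  then show "{window_start c \<epsilon> \<theta> k<..window_start c \<epsilon> \<theta> k + \<epsilon>} \<inter> {window_start c \<epsilon> \<theta> l<..window_start c \<epsilon> \<theta> l + \<epsilon>} = {}"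
    using chosen_windows_ordered[OF assms kl(1,2)] chosen_windows_ordered[OF assms kl(2,1)]
    by cases auto
qed

lemma signed_sum_eq:
  fixes \<theta> :: "nat \<Rightarrow> real"
  shows "(\<Sum>k<n. signed_draw (\<lambda>u. window_incr G \<epsilon> c k u \<omega>) (\<theta> k))
    = (\<Sum>k\<in>{k \<in> chosen_windows G c \<epsilon> n \<theta>. 0 < \<theta> k}. X (window_start c \<epsilon> \<theta> k + \<epsilon>) \<omega> - X (window_start c \<epsilon> \<theta> k) \<omega>)
    - (\<Sum>k\<in>{k \<in> chosen_windows G c \<epsilon> n \<theta>. \<theta> k < 0}. X (window_start c \<epsilon> \<theta> k + \<epsilon>) \<omega> - X (window_start c \<epsilon> \<theta> k) \<omega>)"
    (is "_ = sum ?d ?P - sum ?d ?M")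
proof -
  have "sum ?d ?P = (\<Sum>k<n. if k \<in> ?P then ?d k else 0)" "sum ?d ?M = (\<Sum>k<n. if k \<in> ?M then ?d k else 0)"
    by (auto simp: sum.If_cases chosen_windows_def intro!: sum.cong)
  then have "sum ?d ?P - sum ?d ?M = (\<Sum>k<n. (if k \<in> ?P then ?d k else 0) - (if k \<in> ?M then ?d k else 0))"
    by (simp add: sum_subtractf)
  also have "\<dots> = (\<Sum>k<n. signed_draw (\<lambda>u. window_incr G \<epsilon> c k u \<omega>) (\<theta> k))"
    by (intro sum.cong) (auto simp: signed_draw_def window_incr_def chosen_windows_def window_start_def sgn_if indicator_def)
  finally show ?thesis ..
qed

text \<open>
  By Tonelli, since each point is covered with probability at most $1/q$. The scale
  $\varepsilon'$ at which the energy is measured is unrelated to the scale $\varepsilon$ of the windows.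
\<close>

lemma energy_captured_on_average:
  assumes F[measurable]: "F \<in> sets borel" and G[measurable]: "G \<in> sets borel"
    and sub: "\<And>\<theta>. (\<Union>k\<in>chosen_windows G c \<epsilon> n \<theta>. {window_start c \<epsilon> \<theta> k<..window_start c \<epsilon> \<theta> k + \<epsilon>}) \<subseteq> F"
    and \<epsilon>: "\<epsilon> > 0" and q: "q \<ge> 1"
  defines "R \<equiv> \<lambda>\<theta>. \<Union>k\<in>chosen_windows G c \<epsilon> n \<theta>. {window_start c \<epsilon> \<theta> k<..window_start c \<epsilon> \<theta> k + \<epsilon>}"
    and "Q \<equiv> PiM {..<n} (\<lambda>_. sym_unif q)"
  shows "(\<lambda>(\<theta>, \<omega>). energy (R \<theta>) \<epsilon>' \<omega>) \<in> borel_measurable (Q \<Otimes>\<^sub>M P)"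
    and "\<omega> \<in> space P \<Longrightarrow> (\<integral>\<^sup>+\<theta>. energy (R \<theta>) \<epsilon>' \<omega> \<partial>Q) \<le> energy F \<epsilon>' \<omega> * ennreal (1 / q)"
proof -
  interpret Q: prob_space Q
    unfolding Q_def using q by (intro prob_space_PiM prob_space_sym_unif) simp
  have R: "s \<in> R \<theta> \<longleftrightarrow> (\<exists>k\<in>{..<n}. 0 < \<bar>\<theta> k\<bar> \<and> \<bar>\<theta> k\<bar> < 1 \<and> c + 2 * real k * \<epsilon> + \<epsilon> * \<bar>\<theta> k\<bar> \<in> G \<and>
      c + 2 * real k * \<epsilon> + \<epsilon> * \<bar>\<theta> k\<bar> < s \<and> s \<le> c + 2 * real k * \<epsilon> + \<epsilon> * \<bar>\<theta> k\<bar> + \<epsilon>)" for s \<theta>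
    by (auto simp: R_def chosen_windows_def window_start_def)
  have coord: "(\<lambda>\<theta>. \<theta> k) \<in> borel_measurable Q" if "k \<in> {..<n}" for k
    using measurable_component_singleton[OF that, of "\<lambda>_. sym_unif q"]
    by (simp add: Q_def cong: measurable_cong_sets)
  have ind: "Measurable.pred (Q \<Otimes>\<^sub>M borel) (\<lambda>x. snd x \<in> R (fst x))"
    unfolding R
  proof (rule pred_intros_finite)
    fix k assume "k \<in> {..<n}"
    note [measurable] = measurable_compose[OF measurable_fst coord[OF this]]
    show "Measurable.pred (Q \<Otimes>\<^sub>M borel) (\<lambda>x. 0 < \<bar>fst x k\<bar> \<and> \<bar>fst x k\<bar> < 1 \<and>
        c + 2 * real k * \<epsilon> + \<epsilon> * \<bar>fst x k\<bar> \<in> G \<and> c + 2 * real k * \<epsilon> + \<epsilon> * \<bar>fst x k\<bar> < snd x \<and>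
        snd x \<le> c + 2 * real k * \<epsilon> + \<epsilon> * \<bar>fst x k\<bar> + \<epsilon>)"
      by measurable
  qed simp
  have ind1: "(\<lambda>x. indicator (R (f x)) (g x) :: ennreal) \<in> borel_measurable M"
    if [measurable]: "f \<in> measurable M Q" "g \<in> borel_measurable M" for f g and M :: "'z measure"
  proof -
    have "Measurable.pred M (\<lambda>x. g x \<in> R (f x))"
      using measurable_compose[OF measurable_Pair[OF that] ind] by simp
    then show ?thesis
      unfolding indicator_def by measurable
  qed
  note ind1[measurable (raw)]
  show "(\<lambda>(\<theta>, \<omega>). energy (R \<theta>) \<epsilon>' \<omega>) \<in> borel_measurable (Q \<Otimes>\<^sub>M P)"
    unfolding energy_def split_beta by measurable
  assume \<omega>[measurable]: "\<omega> \<in> space P"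
  define h where "h s = ennreal ((X (s + \<epsilon>') \<omega> - X s \<omega>)\<^sup>2 / \<epsilon>')" for s
  have [measurable]: "h \<in> borel_measurable borel"
    unfolding h_def by measurable
  interpret QL: pair_sigma_finite lborel Q ..
  have cover: "emeasure Q {\<theta> \<in> space Q. s \<in> R \<theta>} \<le> ennreal (1 / q)" for s
  proof -
    have "emeasure Q {\<theta> \<in> space Q. s \<in> R \<theta>} \<le> emeasure Q {\<theta> \<in> space Q.
        \<exists>k<n. 0 < \<bar>\<theta> k\<bar> \<and> \<bar>\<theta> k\<bar> < 1 \<and> c + 2 * real k * \<epsilon> + \<epsilon> * \<bar>\<theta> k\<bar> < s
        \<and> s \<le> c + 2 * real k * \<epsilon> + \<epsilon> * \<bar>\<theta> k\<bar> + \<epsilon>}"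
    proof (rule emeasure_mono)
      have "Measurable.pred Q (\<lambda>\<theta>. \<exists>k\<in>{..<n}. 0 < \<bar>\<theta> k\<bar> \<and> \<bar>\<theta> k\<bar> < 1 \<and> c + 2 * real k * \<epsilon> + \<epsilon> * \<bar>\<theta> k\<bar> < s
        \<and> s \<le> c + 2 * real k * \<epsilon> + \<epsilon> * \<bar>\<theta> k\<bar> + \<epsilon>)"
      proof (rule pred_intros_finite)
        fix k assume "k \<in> {..<n}"
        note [measurable] = coord[OF this]
        show "Measurable.pred Q (\<lambda>\<theta>. 0 < \<bar>\<theta> k\<bar> \<and> \<bar>\<theta> k\<bar> < 1 \<and> c + 2 * real k * \<epsilon> + \<epsilon> * \<bar>\<theta> k\<bar> < s
            \<and> s \<le> c + 2 * real k * \<epsilon> + \<epsilon> * \<bar>\<theta> k\<bar> + \<epsilon>)"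
          by measurable
      qed simp
      from predE[OF this] show "{\<theta> \<in> space Q. \<exists>k<n. 0 < \<bar>\<theta> k\<bar> \<and> \<bar>\<theta> k\<bar> < 1 \<and> c + 2 * real k * \<epsilon> + \<epsilon> * \<bar>\<theta> k\<bar> < s
          \<and> s \<le> c + 2 * real k * \<epsilon> + \<epsilon> * \<bar>\<theta> k\<bar> + \<epsilon>} \<in> sets Q"
        by (simp only: Bex_def lessThan_iff)
    qed (use R in blast)
    also have "\<dots> \<le> ennreal (1 / q)"
      unfolding Q_def by (rule random_windows_cover_rarely[OF q \<epsilon>])
    finally show ?thesis .
  qed
  have "(\<integral>\<^sup>+\<theta>. energy (R \<theta>) \<epsilon>' \<omega> \<partial>Q) = (\<integral>\<^sup>+\<theta>. (\<integral>\<^sup>+s. h s * indicator (R \<theta>) s \<partial>lborel) \<partial>Q)"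
    by (simp add: energy_def h_def)
  also have "\<dots> = (\<integral>\<^sup>+s. (\<integral>\<^sup>+\<theta>. h s * indicator (R \<theta>) s \<partial>Q) \<partial>lborel)"
    by (rule QL.Fubini') (simp add: split_beta)
  also have "\<dots> \<le> (\<integral>\<^sup>+s. h s * indicator F s * ennreal (1 / q) \<partial>lborel)"
  proof (rule nn_integral_mono)
    fix s :: real
    have m: "{\<theta> \<in> space Q. s \<in> R \<theta>} \<in> sets Q"
      using measurable_compose[OF measurable_Pair[OF measurable_ident measurable_const, of s borel] ind] by (simp add: pred_def)
    have "(\<integral>\<^sup>+\<theta>. h s * indicator (R \<theta>) s \<partial>Q) = h s * (\<integral>\<^sup>+\<theta>. indicator {\<theta> \<in> space Q. s \<in> R \<theta>} \<theta> \<partial>Q)"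
      using m by (subst nn_integral_cmult[symmetric]) (auto intro!: nn_integral_cong split: split_indicator)
    also have "\<dots> = h s * emeasure Q {\<theta> \<in> space Q. s \<in> R \<theta>}"
      using m by simp
    also have "\<dots> \<le> h s * indicator F s * ennreal (1 / q)"
    proof (cases "s \<in> F")
      case False
      then have empty: "{\<theta> \<in> space Q. s \<in> R \<theta>} = {}"
        using sub unfolding R_def by blast
      show ?thesis
        unfolding empty by simp
    qed (use cover[of s] in \<open>auto intro: mult_left_mono\<close>)
    finally show "(\<integral>\<^sup>+\<theta>. h s * indicator (R \<theta>) s \<partial>Q) \<le> h s * indicator F s * ennreal (1 / q)" .
  qed
  also have "\<dots> = energy F \<epsilon>' \<omega> * ennreal (1 / q)"
    unfolding energy_def h_def[symmetric] by (subst nn_integral_multc) auto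
  finally show "(\<integral>\<^sup>+\<theta>. energy (R \<theta>) \<epsilon>' \<omega> \<partial>Q) \<le> energy F \<epsilon>' \<omega> * ennreal (1 / q)" .
qed

end

section \<open>Splitting off windows that carry a large increment\<close>

context bounded_uc_process
begin

lemma energy_unbounded_mono:
  assumes "energy_unbounded F a" "F \<subseteq> F'" and [measurable]: "F' \<in> sets borel"
  shows "energy_unbounded F' a"
  unfolding energy_unbounded_def
proof (intro allI impI)
  fix K \<epsilon>0 :: real assume "\<epsilon>0 > 0"
  then obtain \<epsilon> where \<epsilon>: "\<epsilon> > 0" "\<epsilon> < \<epsilon>0" "a < prob {\<omega> \<in> space P. ennreal K < energy F \<epsilon> \<omega>}"
    using assms(1) unfolding energy_unbounded_def by blast
  have "prob {\<omega> \<in> space P. ennreal K < energy F \<epsilon> \<omega>} \<le> prob {\<omega> \<in> space P. ennreal K < energy F' \<epsilon> \<omega>}"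
    by (intro finite_measure_mono) (auto intro: less_le_trans[OF _ energy_mono[OF assms(2)]])
  then show "\<exists>\<epsilon>>0. \<epsilon> < \<epsilon>0 \<and> a < prob {\<omega> \<in> space P. ennreal K < energy F' \<epsilon> \<omega>}"
    using \<epsilon> by (intro exI[of _ \<epsilon>]) auto
qed

text \<open>
  One step of the gliding hump. With probability at least $a/128$ a random choice of windows has a signed
  sum that reaches 2 with probability at least $a/128$. On average it catches a proportion at most $1/q$ of the energy;
  with \<open>q\<close> large, a choice exists that is good in both respects. Either the windows
  with positive sign or those with negative sign already have a large total increment, and only these are removed.
\<close>

lemma split_off_windows:
  assumes unb: "energy_unbounded F a" and cell: "cellular Z F" "finite Z"
    and F[measurable]: "F \<in> sets borel" "F \<subseteq> {0<..T}" and a: "a > 0" and \<beta>: "\<beta> > 0"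
  obtains A :: "nat set" and s :: "nat \<Rightarrow> real" and \<epsilon> :: real
  where "finite A" "\<epsilon> > 0" "disjoint_family_on (\<lambda>k. {s k<..s k + \<epsilon>}) A"
    "(\<Union>k\<in>A. {s k<..s k + \<epsilon>}) \<subseteq> F"
    "a / 256 \<le> prob {\<omega> \<in> space P. 1 \<le> \<bar>\<Sum>k\<in>A. X (s k + \<epsilon>) \<omega> - X (s k) \<omega>\<bar>}"
    "energy_unbounded (F - (\<Union>k\<in>A. {s k<..s k + \<epsilon>})) (a - \<beta>)"
proof -
  define q where "q = 1 + 256 / (a * \<beta>)"
  have q: "q \<ge> 1" "1 / q < a / 128 * (\<beta> / 2)"
  proof -
    have pos: "0 < a * \<beta>"
      using a \<beta> by simp
    then show "q \<ge> 1"
      by (simp add: q_def)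
    have "1 / q = a * \<beta> / (a * \<beta> + 256)"
      using a \<beta> by (simp add: q_def divide_simps)
    also have "\<dots> < a * \<beta> / 256"
      using pos by (intro divide_strict_left_mono) auto
    finally show "1 / q < a / 128 * (\<beta> / 2)"
      by simp
  qed
  obtain \<epsilon> c B v :: real and n :: nat where \<epsilon>: "\<epsilon> > 0" and v: "B > 0" "v \<ge> 8" "v \<ge> (2 * B)\<^sup>2"
    and large: "a / 4 \<le> prob {\<omega> \<in> paths_bounded_by B. ennreal (v * q) \<le>
        (\<Sum>k<n. \<integral>\<^sup>+u\<in>{0..<1}. ennreal ((window_incr (good_starts Z \<epsilon> F) \<epsilon> c k u \<omega>)\<^sup>2) \<partial>lborel)}"
    by (rule large_energy_in_blocks[OF unb F cell(2) a q(1)])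
  define G where "G = good_starts Z \<epsilon> F"
  have G[measurable]: "G \<in> sets borel"
    unfolding G_def using cell F by (intro good_starts_borel)
  define Q where "Q = PiM {..<n} (\<lambda>_. sym_unif q)"
  interpret Q: prob_space Q
    unfolding Q_def using q by (intro prob_space_PiM prob_space_sym_unif) simp
  interpret QP: pair_sigma_finite Q P ..
  define R where "R \<theta> = (\<Union>k\<in>chosen_windows G c \<epsilon> n \<theta>. {window_start c \<epsilon> \<theta> k<..window_start c \<epsilon> \<theta> k + \<epsilon>})" for \<theta>
  have R_sub: "R \<theta> \<subseteq> F" for \<theta>
    unfolding R_def chosen_windows_def G_def using good_starts_window[OF cell(1)] by blast
  have R_borel[measurable]: "R \<theta> \<in> sets borel" for \<theta>
    unfolding R_def by (intro sets.finite_UN) (auto simp: chosen_windows_def)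
  note R_meas = energy_captured_on_average(1)[OF F(1) G R_sub[unfolded R_def] \<epsilon> q(1), folded R_def Q_def]
  note R_avg = energy_captured_on_average(2)[OF F(1) G R_sub[unfolded R_def] \<epsilon> q(1), folded R_def Q_def]
  \<comment> \<open>On the event \<open>D\<close> of a large energy in the blocks, \<open>Y\<close> is large for at least a sixteenth of
    all choices. By Tonelli, many choices then make it large with a probability bounded below.\<close>
  define Y where "Y \<theta> \<omega> = (\<Sum>k<n. signed_draw (\<lambda>u. window_incr G \<epsilon> c k u \<omega>) (\<theta> k))" for \<theta> \<omega>
  have Y_meas[measurable]: "(\<lambda>x. Y (fst x) (snd x)) \<in> borel_measurable (Q \<Otimes>\<^sub>M P)"
    unfolding Y_def signed_draw_def
  proof (rule borel_measurable_sum)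
    fix k assume "k \<in> {..<n}"
    then have "(\<lambda>\<theta>. \<theta> k) \<in> borel_measurable Q"
      using measurable_component_singleton[of k "{..<n}" "\<lambda>_. sym_unif q"]
      by (simp add: Q_def cong: measurable_cong_sets)
    note [measurable] = measurable_compose[OF measurable_fst this]
    show "(\<lambda>x. if 0 < \<bar>fst x k\<bar> \<and> \<bar>fst x k\<bar> < 1
        then sgn (fst x k) * window_incr G \<epsilon> c k \<bar>fst x k\<bar> (snd x) else 0) \<in> borel_measurable (Q \<Otimes>\<^sub>M P)"
      by measurable
  qed
  define H where "H \<theta> = prob {\<omega> \<in> space P. 2 \<le> \<bar>Y \<theta> \<omega>\<bar>}" for \<theta>
  have Y_sec[measurable]: "Y \<theta> \<in> borel_measurable P" for \<theta>
    unfolding Y_def signed_draw_def by measurable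
  have H_eq: "ennreal (H \<theta>) = (\<integral>\<^sup>+\<omega>. indicator {x. 2 \<le> \<bar>x\<bar>} (Y \<theta> \<omega>) \<partial>P)" for \<theta>
  proof -
    have "(\<integral>\<^sup>+\<omega>. indicator {x. 2 \<le> \<bar>x\<bar>} (Y \<theta> \<omega>) \<partial>P) = (\<integral>\<^sup>+\<omega>. indicator {\<omega> \<in> space P. 2 \<le> \<bar>Y \<theta> \<omega>\<bar>} \<omega> \<partial>P)"
      by (intro nn_integral_cong) (auto split: split_indicator)
    then show ?thesis
      by (simp add: H_def emeasure_eq_measure)
  qed
  have ind_meas[measurable]: "(\<lambda>x. indicator {x. 2 \<le> \<bar>x\<bar>} (Y (fst x) (snd x)) :: ennreal) \<in> borel_measurable (Q \<Otimes>\<^sub>M P)"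
    by measurable
  have H_meas[measurable]: "H \<in> borel_measurable Q"
  proof -
    have "(\<lambda>\<theta>. enn2real (\<integral>\<^sup>+\<omega>. indicator {x. 2 \<le> \<bar>x\<bar>} (Y \<theta> \<omega>) \<partial>P)) \<in> borel_measurable Q"
      by (intro borel_measurable_enn2real borel_measurable_nn_integral) (simp add: split_beta)
    then show ?thesis
      by (simp add: H_eq[symmetric] H_def cong: measurable_cong)
  qed
  define D where "D = {\<omega> \<in> paths_bounded_by B. ennreal (v * q) \<le>
        (\<Sum>k<n. \<integral>\<^sup>+u\<in>{0..<1}. ennreal ((window_incr G \<epsilon> c k u \<omega>)\<^sup>2) \<partial>lborel)}"
  have D_space: "D \<subseteq> space P"
    by (auto simp: D_def paths_bounded_by_def)
  have D_eq: "D = paths_bounded_by B \<inter> {\<omega> \<in> space P. ennreal (v * q) \<le>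
        (\<Sum>k<n. \<integral>\<^sup>+u\<in>{0..<1}. ennreal ((window_incr G \<epsilon> c k u \<omega>)\<^sup>2) \<partial>lborel)}"
    by (auto simp: D_def paths_bounded_by_def)
  have D[measurable]: "D \<in> events"
    unfolding D_eq by measurable
  have spread: "ennreal (1 / 16) \<le> (\<integral>\<^sup>+\<theta>. indicator {x. 2 \<le> \<bar>x\<bar>} (Y \<theta> \<omega>) \<partial>Q)" if \<omega>: "\<omega> \<in> D" for \<omega>
  proof -
    have \<omega>P[measurable]: "\<omega> \<in> space P"
      using \<omega> D_space by auto
    have "1 / 16 \<le> measure Q {\<theta> \<in> space Q. v / 2 \<le> (Y \<theta> \<omega>)\<^sup>2}"
      unfolding Q_def Y_def
    proof (rule random_signed_selection[where B = "2 * B"])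
      show "(\<lambda>u. window_incr G \<epsilon> c k u \<omega>) \<in> borel_measurable borel" for k
        by measurable
      show "\<bar>window_incr G \<epsilon> c k u \<omega>\<bar> \<le> 2 * B" for k u
        using increment_bound[of \<omega> B] \<omega> v by (auto simp: window_incr_def D_def indicator_def)
    qed (use q v \<omega> in \<open>auto simp: D_def\<close>)
    moreover have Yq[measurable]: "(\<lambda>\<theta>. Y \<theta> \<omega>) \<in> borel_measurable Q"
      using measurable_compose[OF measurable_Pair[OF measurable_ident measurable_const[OF \<omega>P]] Y_meas] by simp
    have "measure Q {\<theta> \<in> space Q. v / 2 \<le> (Y \<theta> \<omega>)\<^sup>2} \<le> measure Q {\<theta> \<in> space Q. 2 \<le> \<bar>Y \<theta> \<omega>\<bar>}"
    proof (rule Q.finite_measure_mono)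
      have "2 \<le> \<bar>y\<bar>" if "v / 2 \<le> y\<^sup>2" for y :: real
      proof -
        have "2\<^sup>2 \<le> \<bar>y\<bar>\<^sup>2"
          using that v by simp
        then show ?thesis
          by (rule power2_le_imp_le) simp
      qed
      then show "{\<theta> \<in> space Q. v / 2 \<le> (Y \<theta> \<omega>)\<^sup>2} \<subseteq> {\<theta> \<in> space Q. 2 \<le> \<bar>Y \<theta> \<omega>\<bar>}"
        by auto
    qed auto
    ultimately have "ennreal (1 / 16) \<le> emeasure Q {\<theta> \<in> space Q. 2 \<le> \<bar>Y \<theta> \<omega>\<bar>}"
      by (simp add: Q.emeasure_eq_measure)
    also have "\<dots> = (\<integral>\<^sup>+\<theta>. indicator {\<theta> \<in> space Q. 2 \<le> \<bar>Y \<theta> \<omega>\<bar>} \<theta> \<partial>Q)"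
      by simp
    also have "\<dots> = (\<integral>\<^sup>+\<theta>. indicator {x. 2 \<le> \<bar>x\<bar>} (Y \<theta> \<omega>) \<partial>Q)"
      by (intro nn_integral_cong) (auto split: split_indicator)
    finally show ?thesis .
  qed
  have "ennreal (2 * (a / 128)) \<le> ennreal (1 / 16) * emeasure P D"
    using large a by (simp add: emeasure_eq_measure D_def G_def ennreal_mult[symmetric])
  also have "\<dots> = (\<integral>\<^sup>+\<omega>. ennreal (1 / 16) * indicator D \<omega> \<partial>P)"
    by (simp add: nn_integral_cmult_indicator)
  also have "\<dots> \<le> (\<integral>\<^sup>+\<omega>. (\<integral>\<^sup>+\<theta>. indicator {x. 2 \<le> \<bar>x\<bar>} (Y \<theta> \<omega>) \<partial>Q) \<partial>P)"
    using spread by (intro nn_integral_mono) (auto split: split_indicator)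
  also have "\<dots> = (\<integral>\<^sup>+\<theta>. (\<integral>\<^sup>+\<omega>. indicator {x. 2 \<le> \<bar>x\<bar>} (Y \<theta> \<omega>) \<partial>P) \<partial>Q)"
    by (rule QP.Fubini') (simp add: split_beta)
  also have "\<dots> = (\<integral>\<^sup>+\<theta>. ennreal (H \<theta>) \<partial>Q)"
    by (simp add: H_eq)
  finally have H_prob: "a / 128 \<le> Q.prob {\<theta> \<in> space Q. a / 128 \<le> H \<theta>}"
    using a by (intro Q.prob_large_of_integral) (auto simp: H_def)

  \<comment> \<open>A sequence of scales at which the energy on \<open>F\<close> is large. The weights \<open>w\<close> turn the captured energy
    into the captured proportion, which is at most 1 and has mean at most $1/q$ over the choices.\<close>
  have "\<exists>\<epsilon>. 0 < \<epsilon> \<and> \<epsilon> < 1 / real (Suc i) \<and> a < prob {\<omega> \<in> space P. ennreal (2 * real i) < energy F \<epsilon> \<omega>}" for i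
    using unb unfolding energy_unbounded_def by (auto dest!: spec[of _ "2 * real i"] spec[of _ "1 / real (Suc i)"])
  then obtain e where e: "\<And>i. 0 < e i" "\<And>i. e i < 1 / real (Suc i)"
      "\<And>i. a < prob {\<omega> \<in> space P. ennreal (2 * real i) < energy F (e i) \<omega>}"
    by metis
  define w where "w i \<omega> = indicator {x. ennreal (2 * real i) < x} (energy F (e i) \<omega>) * inverse (energy F (e i) \<omega>)" for i \<omega>
  have w_meas[measurable]: "w i \<in> borel_measurable P" for i
    unfolding w_def by measurable
  define J where "J i \<theta> = (\<integral>\<^sup>+\<omega>. w i \<omega> * energy (R \<theta>) (e i) \<omega> \<partial>P)" for i \<theta>
  have wq_meas: "(\<lambda>(\<theta>, \<omega>). w i \<omega> * energy (R \<theta>) (e i) \<omega>) \<in> borel_measurable (Q \<Otimes>\<^sub>M P)" for i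
    using R_meas[of "e i"] unfolding split_beta by measurable
  have J_meas: "J i \<in> borel_measurable Q" for i
    unfolding J_def using wq_meas by (rule borel_measurable_nn_integral)
  have J_avg: "(\<integral>\<^sup>+\<theta>. J i \<theta> \<partial>Q) \<le> ennreal (1 / q)" for i
  proof -
    have sec: "(\<lambda>\<theta>. energy (R \<theta>) (e i) \<omega>) \<in> borel_measurable Q" if "\<omega> \<in> space P" for \<omega>
      using measurable_compose[OF measurable_Pair[OF measurable_ident measurable_const[OF that]] R_meas[of "e i"]] by simp
    have "(\<integral>\<^sup>+\<theta>. J i \<theta> \<partial>Q) = (\<integral>\<^sup>+\<omega>. (\<integral>\<^sup>+\<theta>. w i \<omega> * energy (R \<theta>) (e i) \<omega> \<partial>Q) \<partial>P)"
      unfolding J_def by (rule QP.Fubini'[symmetric]) (rule wq_meas)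
    also have "\<dots> \<le> (\<integral>\<^sup>+\<omega>. ennreal (1 / q) \<partial>P)"
    proof (rule nn_integral_mono)
      fix \<omega> assume \<omega>: "\<omega> \<in> space P"
      have "(\<integral>\<^sup>+\<theta>. w i \<omega> * energy (R \<theta>) (e i) \<omega> \<partial>Q) = w i \<omega> * (\<integral>\<^sup>+\<theta>. energy (R \<theta>) (e i) \<omega> \<partial>Q)"
        using sec[OF \<omega>] by (rule nn_integral_cmult)
      also have "\<dots> \<le> w i \<omega> * (energy F (e i) \<omega> * ennreal (1 / q))"
        by (intro mult_left_mono R_avg \<omega>) simp
      also have "\<dots> = (w i \<omega> * energy F (e i) \<omega>) * ennreal (1 / q)"
        by (simp add: mult.assoc)
      also have "w i \<omega> * energy F (e i) \<omega> \<le> 1"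
        using energy_finite[OF \<omega> e(1) F, of i]
        by (auto simp: w_def split: split_indicator)
           (metis dual_order.refl ennreal_inverse_positive ennreal_mult_divide_eq divide_ennreal_def less_le mult.commute mult.left_neutral not_less_zero order_less_irrefl top.not_eq_extremum)
      finally show "(\<integral>\<^sup>+\<theta>. w i \<omega> * energy (R \<theta>) (e i) \<omega> \<partial>Q) \<le> ennreal (1 / q)"
        by (simp add: mult_right_mono)
    qed
    also have "\<dots> = ennreal (1 / q)"
      by (simp add: emeasure_space_1)
    finally show ?thesis .
  qed
  have "\<exists>\<theta>\<in>{\<theta> \<in> space Q. a / 128 \<le> H \<theta>}. \<exists>\<^sub>F i in sequentially. J i \<theta> \<le> ennreal (\<beta> / 2)"
    by (rule Q.some_point_small_infinitely_often[OF _ H_prob _ J_meas J_avg _ q(2)]) (use a q in auto)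
  then obtain \<theta> where \<theta>: "\<theta> \<in> space Q" "a / 128 \<le> H \<theta>" and freq: "\<exists>\<^sub>F i in sequentially. J i \<theta> \<le> ennreal (\<beta> / 2)"
    by auto
  have rest: "energy_unbounded (F - R \<theta>) (a - \<beta>)"
    unfolding energy_unbounded_def
  proof (intro allI impI)
    fix K \<epsilon>0 :: real assume \<epsilon>0: "\<epsilon>0 > 0"
    have "\<forall>\<^sub>F i in sequentially. K \<le> real i \<and> 1 / real (Suc i) < \<epsilon>0"
      using eventually_ge_at_top[of "nat \<lceil>K\<rceil>"] order_tendstoD(2)[OF LIMSEQ_inverse_real_of_nat \<epsilon>0]
      by eventually_elim (auto simp: inverse_eq_divide; linarith)
    from frequently_ex[OF frequently_eventually_conj[OF freq this]]
    obtain i where i: "J i \<theta> \<le> ennreal (\<beta> / 2)" "K \<le> real i" "1 / real (Suc i) < \<epsilon>0"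
      by blast
    let ?big = "{\<omega> \<in> space P. ennreal (2 * real i) < energy F (e i) \<omega>}"
    let ?left = "{\<omega> \<in> space P. ennreal (real i) < energy (F - R \<theta>) (e i) \<omega>}"
    \<comment> \<open>If removing the windows brings the energy from above $2i$ down to at most \<open>i\<close>, they have captured
      at least half of it. By the choice of $\theta$ this is unlikely.\<close>
    have half: "ennreal (1 / 2) \<le> w i \<omega> * energy (R \<theta>) (e i) \<omega>" if \<omega>: "\<omega> \<in> ?big - ?left" for \<omega>
    proof -
      have eq: "energy F (e i) \<omega> = energy (R \<theta>) (e i) \<omega> + energy (F - R \<theta>) (e i) \<omega>"
        using \<omega> R_sub by (intro energy_Diff) auto
      have "energy F (e i) \<omega> < \<top>"
        using \<omega> e F by (intro energy_finite) auto
      then have "energy (R \<theta>) (e i) \<omega> < \<top>" "energy (F - R \<theta>) (e i) \<omega> < \<top>"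
        unfolding eq by (simp_all add: ennreal_add_eq_top less_top)
      then obtain x y where xy: "energy (R \<theta>) (e i) \<omega> = ennreal x" "energy (F - R \<theta>) (e i) \<omega> = ennreal y" "0 \<le> x" "0 \<le> y"
        by (metis ennreal_cases less_irrefl)
      have Feq: "energy F (e i) \<omega> = ennreal (x + y)"
        using eq xy by simp
      have big: "ennreal (2 * real i) < ennreal (x + y)"
        using \<omega> unfolding Feq[symmetric] by simp
      then have "2 * real i < x + y"
        by (subst (asm) ennreal_less_iff) auto
      moreover have "y \<le> real i"
        using \<omega> xy by (auto simp: not_less)
      ultimately have pos: "0 < x + y" "x + y \<le> 2 * x"
        using xy by linarith+
      have "w i \<omega> = ennreal (1 / (x + y))"
        using big pos unfolding w_def Feq
        by (simp add: inverse_ennreal inverse_eq_divide del: ennreal_plus)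
      then have "w i \<omega> * energy (R \<theta>) (e i) \<omega> = ennreal (x / (x + y))"
        using xy pos by (simp add: ennreal_mult[symmetric])
      moreover have "1 / 2 \<le> x / (x + y)"
        using pos by (simp add: field_simps)
      ultimately show ?thesis
        by (simp only: ennreal_leI)
    qed
    have "ennreal (1 / 2) * emeasure P (?big - ?left) = (\<integral>\<^sup>+\<omega>. ennreal (1 / 2) * indicator (?big - ?left) \<omega> \<partial>P)"
      by (subst nn_integral_cmult_indicator) auto
    also have "\<dots> \<le> J i \<theta>"
      unfolding J_def using half by (intro nn_integral_mono) (auto split: split_indicator)
    also have "\<dots> \<le> ennreal (\<beta> / 2)"
      by fact
    finally have "ennreal (1 / 2 * prob (?big - ?left)) \<le> ennreal (\<beta> / 2)"
      by (simp only: emeasure_eq_measure ennreal_mult measure_nonneg divide_nonneg_nonneg zero_le_one zero_le_numeral)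
    then have lost: "prob (?big - ?left) \<le> \<beta>"
      using \<beta> by (subst (asm) ennreal_le_iff) auto
    have "prob ?big \<le> prob ((?big - ?left) \<union> ?left)"
      by (intro finite_measure_mono) auto
    also have "\<dots> \<le> prob (?big - ?left) + prob ?left"
      by (intro measure_Un_le) auto
    finally have "a - \<beta> < prob ?left"
      using lost e(3)[of i] by linarith
    also have "prob ?left \<le> prob {\<omega> \<in> space P. ennreal K < energy (F - R \<theta>) (e i) \<omega>}"
      using i(2) by (intro finite_measure_mono) (auto intro: le_less_trans[OF ennreal_leI])
    finally show "\<exists>\<epsilon>>0. \<epsilon> < \<epsilon>0 \<and> a - \<beta> < prob {\<omega> \<in> space P. ennreal K < energy (F - R \<theta>) \<epsilon> \<omega>}"
      using e(1,2)[of i] i(3) by (intro exI[of _ "e i"]) auto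
  qed
  let ?d = "\<lambda>k \<omega>. X (window_start c \<epsilon> \<theta> k + \<epsilon>) \<omega> - X (window_start c \<epsilon> \<theta> k) \<omega>"
  let ?P = "{k \<in> chosen_windows G c \<epsilon> n \<theta>. 0 < \<theta> k}" and ?M = "{k \<in> chosen_windows G c \<epsilon> n \<theta>. \<theta> k < 0}"
  have "H \<theta> \<le> prob ({\<omega> \<in> space P. 1 \<le> \<bar>\<Sum>k\<in>?P. ?d k \<omega>\<bar>} \<union> {\<omega> \<in> space P. 1 \<le> \<bar>\<Sum>k\<in>?M. ?d k \<omega>\<bar>})"
    unfolding H_def Y_def signed_sum_eq by (intro finite_measure_mono) auto
  also have "\<dots> \<le> prob {\<omega> \<in> space P. 1 \<le> \<bar>\<Sum>k\<in>?P. ?d k \<omega>\<bar>} + prob {\<omega> \<in> space P. 1 \<le> \<bar>\<Sum>k\<in>?M. ?d k \<omega>\<bar>}"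
    by (intro measure_Un_le) auto
  finally have "a / 256 \<le> prob {\<omega> \<in> space P. 1 \<le> \<bar>\<Sum>k\<in>?P. ?d k \<omega>\<bar>} \<or> a / 256 \<le> prob {\<omega> \<in> space P. 1 \<le> \<bar>\<Sum>k\<in>?M. ?d k \<omega>\<bar>}"
    using \<theta>(2) by linarith
  then have "\<exists>A\<in>{?P, ?M}. a / 256 \<le> prob {\<omega> \<in> space P. 1 \<le> \<bar>\<Sum>k\<in>A. ?d k \<omega>\<bar>}"
    unfolding bex_simps by simp
  then obtain A where "A \<in> {?P, ?M}" and A_large: "a / 256 \<le> prob {\<omega> \<in> space P. 1 \<le> \<bar>\<Sum>k\<in>A. ?d k \<omega>\<bar>}"
    by (elim bexE)
  then have A: "A \<subseteq> chosen_windows G c \<epsilon> n \<theta>"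
    by auto
  have UA: "(\<Union>k\<in>A. {window_start c \<epsilon> \<theta> k<..window_start c \<epsilon> \<theta> k + \<epsilon>}) \<subseteq> R \<theta>"
    using A by (auto simp: R_def)
  have fin: "finite A"
    using A by (rule finite_subset) (simp add: chosen_windows_def)
  show ?thesis
  proof (rule that[OF fin \<epsilon>])
    show "disjoint_family_on (\<lambda>k. {window_start c \<epsilon> \<theta> k<..window_start c \<epsilon> \<theta> k + \<epsilon>}) A"
      using chosen_windows_disjoint[OF \<epsilon>] A by (rule disjoint_family_on_mono[rotated])
    show "energy_unbounded (F - (\<Union>k\<in>A. {window_start c \<epsilon> \<theta> k<..window_start c \<epsilon> \<theta> k + \<epsilon>})) (a - \<beta>)"
      using rest
    proof (rule energy_unbounded_mono)
      show "F - (\<Union>k\<in>A. {window_start c \<epsilon> \<theta> k<..window_start c \<epsilon> \<theta> k + \<epsilon>}) \<in> sets borel"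
        using fin F by (intro sets.Diff sets.finite_UN) auto
    qed (use UA in blast)
  qed (use A_large UA R_sub in auto)
qed

end

section \<open>The gliding hump and power variations\<close>

context bounded_uc_process
begin

definition has_large_increment :: "real \<Rightarrow> real set \<Rightarrow> bool" where
  "has_large_increment p R \<longleftrightarrow> (\<exists>A s \<epsilon>. finite (A :: nat set) \<and> \<epsilon> > 0 \<and>
     disjoint_family_on (\<lambda>k. {s k<..s k + \<epsilon>}) A \<and> R = (\<Union>k\<in>A. {s k<..s k + \<epsilon>}) \<and>
     p \<le> prob {\<omega> \<in> space P. 1 \<le> \<bar>\<Sum>k\<in>A. X (s k + \<epsilon>) \<omega> - X (s k) \<omega>\<bar>})"

text \<open>
  The sets are the successive differences of a decreasing sequence of remaining sets. The probabilities
  $a/2 + a/2^{n+1}$ with which the energy is unbounded on them decrease from \<open>a\<close> but stay above $a/2$.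
\<close>

lemma gliding_hump:
  assumes unb: "energy_unbounded {0<..T} a" and a: "a > 0"
  shows "\<exists>R :: nat \<Rightarrow> real set. disjoint_family R \<and> (\<forall>n. R n \<subseteq> {0<..T} \<and> has_large_increment (a / 512) (R n))"
proof -
  define I where "I n F \<longleftrightarrow> F \<in> sets borel \<and> F \<subseteq> {0<..T} \<and> (\<exists>Z. finite Z \<and> cellular Z F) \<and>
    energy_unbounded F (a / 2 + a / 2 ^ Suc n)" for n :: nat and F
  define N where "N F F' \<longleftrightarrow> F' \<subseteq> F \<and> has_large_increment (a / 512) (F - F')" for F F' :: "real set"
  have "\<exists>F. \<forall>n. I n (F n) \<and> N (F n) (F (Suc n))"
  proof (rule dependent_nat_choice)
    have "I 0 {0<..T}"
      unfolding I_def using unb cellular_interval[of 0 T]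
      by (intro conjI exI[of _ "{0, T}"]) auto
    then show "\<exists>F. I 0 F" ..
    fix F :: "real set" and n :: nat
    assume I: "I n F"
    then obtain Z where F: "F \<in> sets borel" "F \<subseteq> {0<..T}" and Z: "cellular Z F" "finite Z"
      and u: "energy_unbounded F (a / 2 + a / 2 ^ Suc n)"
      by (auto simp: I_def)
    have b: "0 < a / 2 + a / 2 ^ Suc n" "0 < a / 2 ^ Suc (Suc n)"
      using a by (auto intro: add_pos_pos)
    obtain A s \<epsilon> where A: "finite (A :: nat set)" "\<epsilon> > 0" "disjoint_family_on (\<lambda>k. {s k<..s k + \<epsilon>}) A"
      "(\<Union>k\<in>A. {s k<..s k + \<epsilon>}) \<subseteq> F"
      "(a / 2 + a / 2 ^ Suc n) / 256 \<le> prob {\<omega> \<in> space P. 1 \<le> \<bar>\<Sum>k\<in>A. X (s k + \<epsilon>) \<omega> - X (s k) \<omega>\<bar>}"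
      "energy_unbounded (F - (\<Union>k\<in>A. {s k<..s k + \<epsilon>})) (a / 2 + a / 2 ^ Suc n - a / 2 ^ Suc (Suc n))"
      by (rule split_off_windows[OF u Z F b])
    define U where "U = (\<Union>k\<in>A. {s k<..s k + \<epsilon>})"
    have "cellular (Z \<union> (\<Union>k\<in>A. {s k, s k + \<epsilon>})) (F - U)"
      unfolding U_def by (intro cellular_Diff cellular_UN cellular_interval Z)
    moreover have "finite (Z \<union> (\<Union>k\<in>A. {s k, s k + \<epsilon>}))"
      using A(1) Z(2) by auto
    moreover have "U \<in> sets borel"
      unfolding U_def using A(1) by (intro sets.finite_UN) auto
    moreover have eq: "a / 2 + a / 2 ^ Suc n - a / 2 ^ Suc (Suc n) = a / 2 + a / 2 ^ Suc (Suc n)"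
      by (simp add: field_simps)
    have "energy_unbounded (F - U) (a / 2 + a / 2 ^ Suc (Suc n))"
      using A(6) unfolding eq U_def .
    ultimately have "I (Suc n) (F - U)"
      using F unfolding I_def by blast
    moreover have "a / 512 \<le> (a / 2 + a / 2 ^ Suc n) / 256"
      using a by simp
    then have "has_large_increment (a / 512) U"
      unfolding has_large_increment_def U_def using A by (intro exI[of _ A] exI[of _ s] exI[of _ \<epsilon>]) auto
    then have "N F (F - U)"
      using A(4) by (simp add: N_def U_def[symmetric] double_diff)
    ultimately show "\<exists>F'. I (Suc n) F' \<and> N F F'"
      by blast
  qed
  then obtain F where F: "\<And>n. I n (F n)" "\<And>n. N (F n) (F (Suc n))"
    by blast
  define R where "R n = F n - F (Suc n)" for n
  have dec: "F n \<subseteq> F m" if "m \<le> n" for m n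
  proof (rule lift_Suc_antimono_le[OF _ that])
    show "F (Suc k) \<subseteq> F k" for k
      using F(2)[of k] unfolding N_def by (rule conjunct1)
  qed
  have "R m \<inter> R n = {}" if "m < n" for m n
    using dec[of "Suc m" n] that by (auto simp: R_def)
  then have "disjoint_family R"
    unfolding disjoint_family_on_def by (metis Int_commute linorder_neqE_nat)
  moreover have "R n \<subseteq> {0<..T} \<and> has_large_increment (a / 512) (R n)" for n
    using F[of n] by (auto simp: R_def I_def N_def)
  ultimately show ?thesis
    by blast
qed

text \<open>
  The measure enters only through finite additivity on windows and through the fact that its values on
  disjoint sets tend to 0 in probability.
\<close>

lemma no_energy_unbounded:
  assumes incr: "\<And>(A :: nat set) s \<epsilon>. finite A \<Longrightarrow> \<epsilon> > 0 \<Longrightarrow> disjoint_family_on (\<lambda>k. {s k<..s k + \<epsilon>}) A \<Longrightarrow>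
      (\<Union>k\<in>A. {s k<..s k + \<epsilon>}) \<subseteq> {0<..T} \<Longrightarrow>
      AE \<omega> in P. \<mu> (\<Union>k\<in>A. {s k<..s k + \<epsilon>}) \<omega> = (\<Sum>k\<in>A. X (s k + \<epsilon>) \<omega> - X (s k) \<omega>)"
    and meas: "\<And>R. R \<in> sets borel \<Longrightarrow> R \<subseteq> {0<..T} \<Longrightarrow> \<mu> R \<in> borel_measurable P"
    and vanish: "\<And>R :: nat \<Rightarrow> real set. disjoint_family R \<Longrightarrow> (\<And>n. R n \<in> sets borel) \<Longrightarrow> (\<And>n. R n \<subseteq> {0<..T}) \<Longrightarrow>
      (\<lambda>n. prob {\<omega> \<in> space P. 1 \<le> \<bar>\<mu> (R n) \<omega>\<bar>}) \<longlonglongrightarrow> 0"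
    and a: "a > 0"
  shows "\<not> energy_unbounded {0<..T} a"
proof
  assume u: "energy_unbounded {0<..T} a"
  obtain R :: "nat \<Rightarrow> real set" where R: "disjoint_family R" "\<And>n. R n \<subseteq> {0<..T}" "\<And>n. has_large_increment (a / 512) (R n)"
    using gliding_hump[OF u a] by blast
  have borel: "R n \<in> sets borel" and large: "a / 512 \<le> prob {\<omega> \<in> space P. 1 \<le> \<bar>\<mu> (R n) \<omega>\<bar>}" for n
  proof -
    obtain A s \<epsilon> where A: "finite (A :: nat set)" "\<epsilon> > 0" "disjoint_family_on (\<lambda>k. {s k<..s k + \<epsilon>}) A"
      and Rn: "R n = (\<Union>k\<in>A. {s k<..s k + \<epsilon>})"
      and p: "a / 512 \<le> prob {\<omega> \<in> space P. 1 \<le> \<bar>\<Sum>k\<in>A. X (s k + \<epsilon>) \<omega> - X (s k) \<omega>\<bar>}"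
      using R(3)[of n] unfolding has_large_increment_def by blast
    show borel: "R n \<in> sets borel"
      unfolding Rn using A(1) by (intro sets.finite_UN) auto
    have [measurable]: "\<mu> (R n) \<in> borel_measurable P"
      using borel R(2) by (rule meas)
    have "AE \<omega> in P. \<mu> (R n) \<omega> = (\<Sum>k\<in>A. X (s k + \<epsilon>) \<omega> - X (s k) \<omega>)"
      unfolding Rn using A R(2)[of n] by (intro incr) (auto simp: Rn)
    then have "prob {\<omega> \<in> space P. 1 \<le> \<bar>\<mu> (R n) \<omega>\<bar>} = prob {\<omega> \<in> space P. 1 \<le> \<bar>\<Sum>k\<in>A. X (s k + \<epsilon>) \<omega> - X (s k) \<omega>\<bar>}"
      by (intro measure_eq_AE) auto
    then show "a / 512 \<le> prob {\<omega> \<in> space P. 1 \<le> \<bar>\<mu> (R n) \<omega>\<bar>}"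
      using p by simp
  qed
  have "a / 512 \<le> 0"
    using vanish[OF R(1) borel R(2)] large by (intro LIMSEQ_le_const) auto
  then show False
    using a by simp
qed

text \<open>
  The clamped step ranges over $[-d,d]$ as \<open>h\<close> ranges over the line, so that continuity in \<open>h\<close>
  allows the reduction to rational steps.
\<close>

definition modulus_at_most :: "real \<Rightarrow> real \<Rightarrow> 'w set" where
  "modulus_at_most d \<rho> = {\<omega> \<in> space P. \<forall>h t. \<bar>X (t + max (- d) (min d h)) \<omega> - X t \<omega>\<bar> \<le> \<rho>}"

lemma modulus_at_most_events[measurable]: "modulus_at_most d \<rho> \<in> events"
proof -
  have "(\<forall>h t. \<bar>X (t + max (- d) (min d h)) \<omega> - X t \<omega>\<bar> \<le> \<rho>) \<longleftrightarrow>
      (\<forall>h t :: rat. \<bar>X (of_rat t + max (- d) (min d (of_rat h))) \<omega> - X (of_rat t) \<omega>\<bar> \<le> \<rho>)"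
    if \<omega>: "\<omega> \<in> space P" for \<omega>
  proof -
    note cont = continuous_on_compose2[OF X_cont[OF \<omega>]]
    have "(\<forall>h. \<bar>X (t + max (- d) (min d h)) \<omega> - X t \<omega>\<bar> \<le> \<rho>) \<longleftrightarrow>
        (\<forall>h :: rat. \<bar>X (t + max (- d) (min d (of_rat h))) \<omega> - X t \<omega>\<bar> \<le> \<rho>)" for t
      by (intro continuous_le_iff_rat continuous_intros cont) auto
    moreover have "(\<forall>t. \<bar>X (t + max (- d) (min d h)) \<omega> - X t \<omega>\<bar> \<le> \<rho>) \<longleftrightarrow>
        (\<forall>t :: rat. \<bar>X (of_rat t + max (- d) (min d h)) \<omega> - X (of_rat t) \<omega>\<bar> \<le> \<rho>)" for h
      by (intro continuous_le_iff_rat continuous_intros cont X_cont \<omega>) auto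
    ultimately show ?thesis
      by (simp only: all_comm[where P = "\<lambda>h t. \<bar>X (t + max (- d) (min d h)) \<omega> - X t \<omega>\<bar> \<le> \<rho>"]) blast
  qed
  then have "modulus_at_most d \<rho> = {\<omega> \<in> space P.
      \<forall>h t :: rat. \<bar>X (of_rat t + max (- d) (min d (of_rat h))) \<omega> - X (of_rat t) \<omega>\<bar> \<le> \<rho>}"
    unfolding modulus_at_most_def by blast
  then show ?thesis
    by simp
qed

lemma modulus_leD:
  assumes "\<omega> \<in> modulus_at_most d \<rho>" "\<bar>h\<bar> \<le> d"
  shows "\<bar>X (t + h) \<omega> - X t \<omega>\<bar> \<le> \<rho>"
proof -
  have "max (- d) (min d h) = h"
    using assms(2) by auto
  moreover have "\<forall>h t. \<bar>X (t + max (- d) (min d h)) \<omega> - X t \<omega>\<bar> \<le> \<rho>"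
    using assms(1) unfolding modulus_at_most_def by blast
  ultimately show ?thesis
    by metis
qed

lemma prob_modulus_at_most:
  assumes \<rho>: "\<rho> > 0" and \<eta>: "\<eta> > 0"
  obtains d where "d > 0" "prob (modulus_at_most d \<rho>) > 1 - \<eta>"
proof -
  define d where "d n = 1 / real (Suc n)" for n
  have "(\<lambda>n. prob (modulus_at_most (d n) \<rho>)) \<longlonglongrightarrow> prob (\<Union>n. modulus_at_most (d n) \<rho>)"
  proof (rule finite_Lim_measure_incseq)
    show "incseq (\<lambda>n. modulus_at_most (d n) \<rho>)"
    proof (intro incseq_SucI subsetI)
      fix n \<omega> assume \<omega>: "\<omega> \<in> modulus_at_most (d n) \<rho>"
      have "d (Suc n) \<le> d n" "0 < d (Suc n)"
        by (auto simp: d_def frac_le)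
      then show "\<omega> \<in> modulus_at_most (d (Suc n)) \<rho>"
        using \<omega> modulus_leD[OF \<omega>] unfolding modulus_at_most_def by auto
    qed
  qed auto
  moreover have "(\<Union>n. modulus_at_most (d n) \<rho>) = space P"
  proof safe
    fix \<omega> assume \<omega>: "\<omega> \<in> space P"
    from uniformly_continuous_onE[OF X_ucont[OF \<omega>] \<rho>] obtain e where e: "e > 0"
      "\<And>s t. dist s t < e \<Longrightarrow> dist (X s \<omega>) (X t \<omega>) < \<rho>"
      by (metis UNIV_I)
    obtain n where n: "d n < e"
      using reals_Archimedean[OF e(1)] by (auto simp: d_def inverse_eq_divide)
    have "\<bar>X (t + max (- d n) (min (d n) h)) \<omega> - X t \<omega>\<bar> \<le> \<rho>" for h t
    proof -
      have "0 < d n"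
        by (simp add: d_def)
      then have "\<bar>max (- d n) (min (d n) h)\<bar> < e"
        using n by (auto simp: max_def min_def)
      then show ?thesis
        using e(2)[of "t + max (- d n) (min (d n) h)" t] by (auto simp: dist_real_def)
    qed
    then show "\<omega> \<in> (\<Union>n. modulus_at_most (d n) \<rho>)"
      using \<omega> by (auto simp: modulus_at_most_def)
  qed (auto simp: modulus_at_most_def)
  ultimately have "\<forall>\<^sub>F n in sequentially. 1 - \<eta> < prob (modulus_at_most (d n) \<rho>)"
    using \<eta> by (intro order_tendstoD(1)[of _ 1]) (auto simp: prob_space)
  then obtain n where "prob (modulus_at_most (d n) \<rho>) > 1 - \<eta>"
    by (auto dest!: eventually_happens)
  then show ?thesis
    using that[of "d n"] by (simp add: d_def)
qed

definition power_variation :: "real \<Rightarrow> real \<Rightarrow> real \<Rightarrow> 'w \<Rightarrow> real" where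
  "power_variation T p \<epsilon> \<omega> = 1 / \<epsilon> * (LINT s:{0..T}|lborel. \<bar>X (s + \<epsilon>) \<omega> - X s \<omega>\<bar> powr p)"

lemma power_variation_measurable[measurable]: "power_variation T p \<epsilon> \<in> borel_measurable P"
  unfolding power_variation_def set_lebesgue_integral_def by measurable

lemma power_variation_nonneg: "\<epsilon> > 0 \<Longrightarrow> 0 \<le> power_variation T p \<epsilon> \<omega>"
  unfolding power_variation_def set_lebesgue_integral_def
  by (intro mult_nonneg_nonneg Bochner_Integration.integral_nonneg) auto

text \<open>
  The pointwise bound $|x|^p \le \rho^{p-2} x^2$ for $|x|\le\rho$, integrated.
\<close>

lemma power_variation_le_modulus:
  assumes p: "p \<ge> 2" and \<epsilon>: "0 < \<epsilon>" "\<epsilon> \<le> d" and \<omega>: "\<omega> \<in> modulus_at_most d \<rho>" and \<rho>: "\<rho> > 0"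
    and K: "energy {0<..T} \<epsilon> \<omega> \<le> ennreal K" "K \<ge> 0"
  shows "power_variation T p \<epsilon> \<omega> \<le> \<rho> powr (p - 2) * K"
proof -
  have \<omega>P[measurable]: "\<omega> \<in> space P"
    using \<omega> by (simp add: modulus_at_most_def)
  let ?d = "\<lambda>s. X (s + \<epsilon>) \<omega> - X s \<omega>"
  have [measurable]: "(\<lambda>s. X (s + \<epsilon>) \<omega>) \<in> borel_measurable borel" "(\<lambda>s. X s \<omega>) \<in> borel_measurable borel"
    by measurable
  have pw: "1 / \<epsilon> * \<bar>?d s\<bar> powr p \<le> \<rho> powr (p - 2) * ((?d s)\<^sup>2 / \<epsilon>)" for s
  proof (cases "?d s = 0")
    case False
    have "\<bar>?d s\<bar> powr p = \<bar>?d s\<bar> powr (p - 2) * \<bar>?d s\<bar> powr 2"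
      using powr_add[of "\<bar>?d s\<bar>" "p - 2" 2] by simp
    also have "\<bar>?d s\<bar> powr 2 = (?d s)\<^sup>2"
      using False by simp
    also have "\<bar>?d s\<bar> powr (p - 2) \<le> \<rho> powr (p - 2)"
      using modulus_leD[OF \<omega>, of \<epsilon> s] \<epsilon> p by (intro powr_mono2) auto
    finally have "\<bar>?d s\<bar> powr p \<le> \<rho> powr (p - 2) * (?d s)\<^sup>2"
      by (simp add: mult_right_mono)
    then show ?thesis
      using \<epsilon> by (simp add: divide_right_mono)
  qed simp
  have "power_variation T p \<epsilon> \<omega> = (LINT s|lborel. indicator {0..T} s * (1 / \<epsilon> * \<bar>?d s\<bar> powr p))"
    unfolding power_variation_def set_lebesgue_integral_def
    by (subst integral_mult_right_zero[symmetric]) (simp add: mult_ac)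
  also have "\<dots> = enn2real (\<integral>\<^sup>+s. ennreal (indicator {0..T} s * (1 / \<epsilon> * \<bar>?d s\<bar> powr p)) \<partial>lborel)"
    using \<epsilon> by (intro integral_eq_nn_integral) auto
  also have "\<dots> \<le> \<rho> powr (p - 2) * K"
  proof (rule enn2real_leI)
    have "(\<integral>\<^sup>+s. ennreal (indicator {0..T} s * (1 / \<epsilon> * \<bar>?d s\<bar> powr p)) \<partial>lborel)
        = (\<integral>\<^sup>+s. ennreal (indicator {0<..T} s * (1 / \<epsilon> * \<bar>?d s\<bar> powr p)) \<partial>lborel)"
      by (rule nn_integral_cong_AE)
         (use AE_lborel_singleton[of 0] in \<open>eventually_elim; auto split: split_indicator\<close>)
    also have "\<dots> \<le> (\<integral>\<^sup>+s. ennreal (\<rho> powr (p - 2)) * (ennreal ((?d s)\<^sup>2 / \<epsilon>) * indicator {0<..T} s) \<partial>lborel)"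
      using pw \<epsilon> by (intro nn_integral_mono) (auto split: split_indicator simp: ennreal_mult[symmetric] intro!: ennreal_leI)
    also have "\<dots> = ennreal (\<rho> powr (p - 2)) * energy {0<..T} \<epsilon> \<omega>"
      unfolding energy_def by (subst nn_integral_cmult) auto
    also have "\<dots> \<le> ennreal (\<rho> powr (p - 2)) * ennreal K"
      by (intro mult_left_mono K) simp
    also have "\<dots> = ennreal (\<rho> powr (p - 2) * K)"
      using K by (subst ennreal_mult) auto
    finally show "(\<integral>\<^sup>+s. ennreal (indicator {0..T} s * (1 / \<epsilon> * \<bar>?d s\<bar> powr p)) \<partial>lborel) \<le> ennreal (\<rho> powr (p - 2) * K)" .
  qed (use K in auto)
  finally show ?thesis .
qed

text \<open>
  The energy is at most \<open>K\<close> with high probability at all small scales, and the modulus $\rho$ can be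
  taken so small that $\rho^{p-2}K$ is the prescribed threshold.
\<close>

lemma power_variation_tendsto_0:
  assumes bdd: "\<And>a. a > 0 \<Longrightarrow> \<not> energy_unbounded {0<..T} a" and p: "p > 2" and \<kappa>: "\<kappa> > 0"
  shows "((\<lambda>\<epsilon>. prob {\<omega> \<in> space P. power_variation T p \<epsilon> \<omega> > \<kappa>}) \<longlongrightarrow> 0) (at_right 0)"
proof (rule order_tendstoI)
  fix \<eta> :: real assume \<eta>: "0 < \<eta>"
  obtain K0 \<epsilon>0 where \<epsilon>0: "\<epsilon>0 > 0"
    and K0: "\<And>\<epsilon>. 0 < \<epsilon> \<Longrightarrow> \<epsilon> < \<epsilon>0 \<Longrightarrow> prob {\<omega> \<in> space P. ennreal K0 < energy {0<..T} \<epsilon> \<omega>} \<le> \<eta> / 2"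
  proof -
    have "\<exists>K0. \<exists>\<epsilon>0>0. \<forall>\<epsilon>>0. \<epsilon> < \<epsilon>0 \<longrightarrow> prob {\<omega> \<in> space P. ennreal K0 < energy {0<..T} \<epsilon> \<omega>} \<le> \<eta> / 2"
    proof (rule ccontr)
      assume "\<not> ?thesis"
      then have "energy_unbounded {0<..T} (\<eta> / 2)"
        unfolding energy_unbounded_def by (simp only: not_ex not_all not_imp de_Morgan_conj not_le) blast
      then show False
        using bdd[of "\<eta> / 2"] \<eta> by simp
    qed
    then show ?thesis
      using that by blast
  qed
  define K where "K = max K0 1"
  define \<rho> where "\<rho> = (\<kappa> / K) powr (1 / (p - 2))"
  have K: "K > 0" "K0 \<le> K"
    by (auto simp: K_def)
  have \<rho>: "\<rho> > 0" "\<rho> powr (p - 2) * K = \<kappa>"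
    using \<kappa> K p by (auto simp: \<rho>_def powr_powr)
  obtain d where d: "d > 0" "prob (modulus_at_most d \<rho>) > 1 - \<eta> / 2"
    using prob_modulus_at_most[OF \<rho>(1), of "\<eta> / 2"] \<eta> by auto
  have small: "prob {\<omega> \<in> space P. power_variation T p \<epsilon> \<omega> > \<kappa>} < \<eta>" if \<epsilon>: "0 < \<epsilon>" "\<epsilon> < min \<epsilon>0 d" for \<epsilon>
  proof -
    let ?Q = "{\<omega> \<in> space P. ennreal K0 < energy {0<..T} \<epsilon> \<omega>}"
    have "{\<omega> \<in> space P. power_variation T p \<epsilon> \<omega> > \<kappa>} \<subseteq> ?Q \<union> (space P - modulus_at_most d \<rho>)"
    proof
      fix \<omega> assume \<omega>: "\<omega> \<in> {\<omega> \<in> space P. power_variation T p \<epsilon> \<omega> > \<kappa>}"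
      show "\<omega> \<in> ?Q \<union> (space P - modulus_at_most d \<rho>)"
      proof (rule ccontr)
        assume "\<omega> \<notin> ?Q \<union> (space P - modulus_at_most d \<rho>)"
        then have "\<omega> \<in> modulus_at_most d \<rho>" "energy {0<..T} \<epsilon> \<omega> \<le> ennreal K0"
          using \<omega> by auto
        then have "energy {0<..T} \<epsilon> \<omega> \<le> ennreal K" "\<omega> \<in> modulus_at_most d \<rho>"
          using K(2) by (auto intro: order.trans ennreal_leI)
        then have "power_variation T p \<epsilon> \<omega> \<le> \<rho> powr (p - 2) * K"
          using p \<epsilon> \<rho> K by (intro power_variation_le_modulus[where d = d]) auto
        then show False
          using \<omega> \<rho> by simp
      qed
    qed
    then have "prob {\<omega> \<in> space P. power_variation T p \<epsilon> \<omega> > \<kappa>} \<le> prob (?Q \<union> (space P - modulus_at_most d \<rho>))"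
      by (intro finite_measure_mono) auto
    also have "\<dots> \<le> prob ?Q + prob (space P - modulus_at_most d \<rho>)"
      by (intro measure_Un_le) auto
    also have "\<dots> < \<eta>"
      using K0[of \<epsilon>] \<epsilon> d(2) by (simp add: prob_compl)
    finally show ?thesis .
  qed
  then show "\<forall>\<^sub>F \<epsilon> in at_right 0. prob {\<omega> \<in> space P. power_variation T p \<epsilon> \<omega> > \<kappa>} < \<eta>"
    using \<epsilon>0 d(1) by (auto simp: eventually_at_right_field intro!: exI[of _ "min \<epsilon>0 d"])
next
  fix b :: real assume "b < 0"
  then show "\<forall>\<^sub>F \<epsilon> in at_right 0. b < prob {\<omega> \<in> space P. power_variation T p \<epsilon> \<omega> > \<kappa>}"
    by (intro always_eventually allI less_le_trans[OF _ measure_nonneg])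
qed

end

section \<open>Cubic variation\<close>

text \<open>
  Needed to replace a supremum over all times by one over countably many.
\<close>

lemma continuous_on_integral_upto:
  fixes f :: "real \<Rightarrow> real"
  assumes [measurable]: "f \<in> borel_measurable borel" and C: "\<And>s. \<bar>f s\<bar> \<le> C"
  shows "continuous_on UNIV (\<lambda>r. LINT s:{0..max 0 (min T r)}|lborel. f s)"
proof (rule continuous_on_sequentiallyI)
  fix u :: "nat \<Rightarrow> real" and r :: real
  assume u: "u \<longlonglongrightarrow> r"
  define c where "c x = max 0 (min T x)" for x :: real
  have c: "(\<lambda>n. c (u n)) \<longlonglongrightarrow> c r"
    unfolding c_def by (intro tendsto_intros u)
  have "(\<lambda>n. LINT s|lborel. indicator {0..c (u n)} s *\<^sub>R f s) \<longlonglongrightarrow> (LINT s|lborel. indicator {0..c r} s *\<^sub>R f s)"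
  proof (rule integral_dominated_convergence[where w = "\<lambda>s. C * indicator {0..max 0 T} s"])
    show "AE s in lborel. (\<lambda>n. indicator {0..c (u n)} s *\<^sub>R f s) \<longlonglongrightarrow> indicator {0..c r} s *\<^sub>R f s"
      using AE_lborel_singleton[of "c r"]
    proof eventually_elim
      fix s assume "s \<noteq> c r"
      then consider "s < c r" | "c r < s"
        by linarith
      then have "\<forall>\<^sub>F n in sequentially. indicator {0..c (u n)} s = (indicator {0..c r} s :: real)"
      proof cases
        case 1
        show ?thesis
          by (rule eventually_mono[OF order_tendstoD(1)[OF c 1]]) (use 1 in \<open>auto split: split_indicator\<close>)
      next
        case 2
        show ?thesis
          by (rule eventually_mono[OF order_tendstoD(2)[OF c 2]]) (use 2 in \<open>auto split: split_indicator\<close>)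
      qed
      then show "(\<lambda>n. indicator {0..c (u n)} s *\<^sub>R f s) \<longlonglongrightarrow> indicator {0..c r} s *\<^sub>R f s"
        by (intro tendsto_scaleR tendsto_const tendsto_eventually)
    qed
    have "0 \<le> C"
      using C[of 0] by linarith
    then show "AE s in lborel. norm (indicator {0..c (u n)} s *\<^sub>R f s) \<le> C * indicator {0..max 0 T} s" for n
      using C by (auto simp: c_def split: split_indicator)
  qed (auto simp: emeasure_lborel_Icc_eq)
  then show "(\<lambda>n. LINT s:{0..max 0 (min T (u n))}|lborel. f s) \<longlonglongrightarrow> (LINT s:{0..max 0 (min T r)}|lborel. f s)"
    by (simp add: set_lebesgue_integral_def c_def)
qed

lemma SUP_rat_of_continuous:
  fixes f :: "real \<Rightarrow> real"
  assumes "continuous_on UNIV f"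
  shows "(SUP x. ennreal \<bar>f x\<bar>) = (SUP r :: rat. ennreal \<bar>f (of_rat r)\<bar>)"
proof (rule antisym)
  show "(SUP x. ennreal \<bar>f x\<bar>) \<le> (SUP r :: rat. ennreal \<bar>f (of_rat r)\<bar>)"
  proof (cases "SUP r :: rat. ennreal \<bar>f (of_rat r)\<bar>")
    case (real b)
    have "ennreal \<bar>f (of_rat r)\<bar> \<le> ennreal b" for r :: rat
      unfolding real(2)[symmetric] by (rule SUP_upper) simp
    then have "\<forall>r :: rat. \<bar>f (of_rat r)\<bar> \<le> b"
      using real(1) by simp
    then have "\<forall>x. \<bar>f x\<bar> \<le> b"
      by (subst continuous_le_iff_rat) (auto intro: continuous_intros assms)
    then show ?thesis
      unfolding real(2) by (intro SUP_least ennreal_leI) auto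
  next
    case top
    then show ?thesis
      by (simp only: top_greatest)
  qed
qed (auto intro!: SUP_least SUP_upper2)

context bounded_uc_process
begin

definition cubic_variation :: "real \<Rightarrow> real \<Rightarrow> 'w \<Rightarrow> real" where
  "cubic_variation \<epsilon> t \<omega> = 1 / \<epsilon> * (LINT s:{0..t}|lborel. (X (s + \<epsilon>) \<omega> - X s \<omega>) ^ 3)"

lemma cubic_variation_measurable[measurable]: "cubic_variation \<epsilon> t \<in> borel_measurable P"
  unfolding cubic_variation_def set_lebesgue_integral_def by measurable

lemma cubic_variation_le_power_variation:
  assumes \<omega>[measurable]: "\<omega> \<in> space P" and t: "t \<le> T" and \<epsilon>: "\<epsilon> > 0"
  shows "\<bar>cubic_variation \<epsilon> t \<omega>\<bar> \<le> power_variation T 3 \<epsilon> \<omega>"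
proof -
  let ?d = "\<lambda>s. X (s + \<epsilon>) \<omega> - X s \<omega>"
  obtain B where B: "\<omega> \<in> paths_bounded_by B"
    using X_bdd[OF \<omega>] \<omega> by (auto simp: paths_bounded_by_def)
  have bnd: "\<bar>?d s\<bar> ^ 3 \<le> (2 * B) ^ 3" for s
    using increment_bound[OF B, of "s + \<epsilon>" s] by (intro power_mono) auto
  have int: "integrable lborel (\<lambda>s. indicator {0..b} s *\<^sub>R \<bar>?d s\<bar> ^ 3)" for b
  proof (rule integrableI_bounded_set_indicator[where B = "(2 * B) ^ 3"])
    show "AE s in lborel. s \<in> {0..b} \<longrightarrow> norm (\<bar>?d s\<bar> ^ 3) \<le> (2 * B) ^ 3"
      using bnd by simp
  qed (auto simp: emeasure_lborel_Icc_eq)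
  have "\<bar>LINT s:{0..t}|lborel. ?d s ^ 3\<bar> \<le> (LINT s|lborel. indicator {0..t} s *\<^sub>R \<bar>?d s\<bar> ^ 3)"
    unfolding set_lebesgue_integral_def
    by (rule order.trans[OF integral_abs_bound]) (simp add: abs_mult power_abs)
  also have "\<dots> \<le> (LINT s|lborel. indicator {0..T} s *\<^sub>R \<bar>?d s\<bar> ^ 3)"
    using t by (intro integral_mono int) (auto split: split_indicator)
  also have "\<dots> = (LINT s:{0..T}|lborel. \<bar>?d s\<bar> powr 3)"
    unfolding set_lebesgue_integral_def by simp
  finally show ?thesis
    using \<epsilon> unfolding cubic_variation_def power_variation_def by (simp add: abs_mult divide_right_mono)
qed

lemma cubic_variation_SUP_measurable:
  assumes T: "T \<ge> 0"
  shows "(\<lambda>\<omega>. SUP t\<in>{0..T}. ennreal \<bar>cubic_variation \<epsilon> t \<omega>\<bar>) \<in> borel_measurable P"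
proof -
  have range: "{0..T} = range (\<lambda>r. max 0 (min T r))"
  proof
    show "{0..T} \<subseteq> range (\<lambda>r. max 0 (min T r))"
    proof
      fix t assume "t \<in> {0..T}"
      then have "t = max 0 (min T t)"
        by auto
      then show "t \<in> range (\<lambda>r. max 0 (min T r))"
        by blast
    qed
  qed (use T in auto)
  have "(SUP t\<in>{0..T}. ennreal \<bar>cubic_variation \<epsilon> t \<omega>\<bar>) = (SUP r :: rat. ennreal \<bar>cubic_variation \<epsilon> (max 0 (min T (of_rat r))) \<omega>\<bar>)"
    if \<omega>[measurable]: "\<omega> \<in> space P" for \<omega>
  proof -
    obtain B where B: "\<omega> \<in> paths_bounded_by B"
      using X_bdd[OF \<omega>] \<omega> by (auto simp: paths_bounded_by_def)
    have "\<bar>(X (s + \<epsilon>) \<omega> - X s \<omega>) ^ 3\<bar> \<le> (2 * B) ^ 3" for s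
      using increment_bound[OF B, of "s + \<epsilon>" s] unfolding power_abs by (intro power_mono) auto
    then have "continuous_on UNIV (\<lambda>r. cubic_variation \<epsilon> (max 0 (min T r)) \<omega>)"
      unfolding cubic_variation_def by (intro continuous_intros continuous_on_integral_upto[where C = "(2 * B) ^ 3"]) auto
    from SUP_rat_of_continuous[OF this] show ?thesis
      unfolding range image_image .
  qed
  moreover have "(\<lambda>\<omega>. SUP r :: rat. ennreal \<bar>cubic_variation \<epsilon> (max 0 (min T (of_rat r))) \<omega>\<bar>) \<in> borel_measurable P"
    by measurable
  ultimately show ?thesis
    by (simp cong: measurable_cong)
qed

lemma power_variation_conv:
  assumes bdd: "\<And>a. a > 0 \<Longrightarrow> \<not> energy_unbounded {0<..T} a" and p: "p > 2"
  shows "conv_in_prob P (power_variation T p) (\<lambda>\<omega>. 0) (at_right 0)"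
  unfolding conv_in_prob_def
proof (intro conjI allI impI)
  fix e :: real assume "e > 0"
  have "\<forall>\<^sub>F \<epsilon> in at_right 0. prob {\<omega> \<in> space P. e < power_variation T p \<epsilon> \<omega>} = prob {\<omega> \<in> space P. e < \<bar>power_variation T p \<epsilon> \<omega> - 0\<bar>}"
    using eventually_at_right_less[of "0::real"] by eventually_elim (simp add: power_variation_nonneg)
  then show "((\<lambda>\<epsilon>. prob {\<omega> \<in> space P. e < \<bar>power_variation T p \<epsilon> \<omega> - 0\<bar>}) \<longlongrightarrow> 0) (at_right 0)"
    using power_variation_tendsto_0[OF bdd p \<open>e > 0\<close>] by (rule Lim_transform_eventually[rotated])
qed auto

lemma cubic_variation_conv:
  assumes bdd: "\<And>a. a > 0 \<Longrightarrow> \<not> energy_unbounded {0<..T} a" and T: "T \<ge> 0"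
  shows "unif_conv_in_prob P {0..T} cubic_variation (\<lambda>t \<omega>. 0) (at_right 0)"
  unfolding unif_conv_in_prob_def
proof (intro conjI allI impI ballI)
  have meas: "(\<lambda>\<omega>. SUP t\<in>{0..T}. ennreal \<bar>cubic_variation \<epsilon> t \<omega> - 0\<bar>) \<in> borel_measurable P" for \<epsilon>
    using cubic_variation_SUP_measurable[OF T] by simp
  then show "\<forall>\<^sub>F \<epsilon> in at_right 0. (\<lambda>\<omega>. SUP t\<in>{0..T}. ennreal \<bar>cubic_variation \<epsilon> t \<omega> - 0\<bar>) \<in> borel_measurable P"
    by simp
  fix e :: real assume e: "e > 0"
  have upper: "\<forall>\<^sub>F \<epsilon> in at_right 0. prob {\<omega> \<in> space P. ennreal e < (SUP t\<in>{0..T}. ennreal \<bar>cubic_variation \<epsilon> t \<omega> - 0\<bar>)}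
      \<le> prob {\<omega> \<in> space P. e < power_variation T 3 \<epsilon> \<omega>}"
    using eventually_at_right_less[of "0::real"]
  proof eventually_elim
    fix \<epsilon> :: real assume \<epsilon>: "0 < \<epsilon>"
    have le: "(SUP t\<in>{0..T}. ennreal \<bar>cubic_variation \<epsilon> t \<omega> - 0\<bar>) \<le> ennreal (power_variation T 3 \<epsilon> \<omega>)" if "\<omega> \<in> space P" for \<omega>
      using cubic_variation_le_power_variation[OF that _ \<epsilon>] by (intro SUP_least ennreal_leI) auto
    show "prob {\<omega> \<in> space P. ennreal e < (SUP t\<in>{0..T}. ennreal \<bar>cubic_variation \<epsilon> t \<omega> - 0\<bar>)}
      \<le> prob {\<omega> \<in> space P. e < power_variation T 3 \<epsilon> \<omega>}"
    proof (intro finite_measure_mono subsetI)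
      fix \<omega> assume \<omega>: "\<omega> \<in> {\<omega> \<in> space P. ennreal e < (SUP t\<in>{0..T}. ennreal \<bar>cubic_variation \<epsilon> t \<omega> - 0\<bar>)}"
      then have "ennreal e < ennreal (power_variation T 3 \<epsilon> \<omega>)"
        using le[of \<omega>] by (blast intro: less_le_trans)
      then have "e < power_variation T 3 \<epsilon> \<omega>"
        using e by (subst (asm) ennreal_less_iff) auto
      then show "\<omega> \<in> {\<omega> \<in> space P. e < power_variation T 3 \<epsilon> \<omega>}"
        using \<omega> by blast
    qed measurable
  qed
  have lim: "((\<lambda>\<epsilon>. prob {\<omega> \<in> space P. e < power_variation T 3 \<epsilon> \<omega>}) \<longlongrightarrow> 0) (at_right 0)"
    by (rule power_variation_tendsto_0[OF bdd _ e]) auto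
  show "((\<lambda>\<epsilon>. prob {\<omega> \<in> space P. ennreal e < (SUP t\<in>{0..T}. ennreal \<bar>cubic_variation \<epsilon> t \<omega> - 0\<bar>)}) \<longlongrightarrow> 0) (at_right 0)"
    by (rule tendsto_sandwich[OF _ upper tendsto_const lim]) simp
qed auto

lemma power_variation_subseq_bounded:
  assumes bdd: "\<And>a. a > 0 \<Longrightarrow> \<not> energy_unbounded {0<..T} a" and p: "p > 2"
    and \<epsilon>: "\<And>i. 0 < \<epsilon> i" "\<epsilon> \<longlonglongrightarrow> 0"
  obtains r :: "nat \<Rightarrow> nat"
  where "strict_mono r" "AE \<omega> in P. \<forall>\<^sub>F i in sequentially. power_variation T p (\<epsilon> (r i)) \<omega> \<le> 1"
proof -
  have "filterlim \<epsilon> (at_right 0) sequentially"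
    using \<epsilon> by (intro tendsto_imp_filterlim_at_right) auto
  from filterlim_compose[OF power_variation_tendsto_0[OF bdd p zero_less_one] this]
  have lim: "(\<lambda>i. prob {\<omega> \<in> space P. 1 < power_variation T p (\<epsilon> i) \<omega>}) \<longlonglongrightarrow> 0" .
  have "\<exists>r. strict_mono r \<and> (\<forall>n. prob {\<omega> \<in> space P. 1 < power_variation T p (\<epsilon> (r n)) \<omega>} < (1 / 2) ^ n)"
  proof -
    have "\<exists>r. (\<forall>n. prob {\<omega> \<in> space P. 1 < power_variation T p (\<epsilon> (r n)) \<omega>} < (1 / 2) ^ n) \<and> (\<forall>n. r n < r (Suc n))"
    proof (rule dependent_nat_choice[where P = "\<lambda>n k. prob {\<omega> \<in> space P. 1 < power_variation T p (\<epsilon> k) \<omega>} < (1 / 2) ^ n" and Q = "\<lambda>n k k'. k < k'", unfolded all_conj_distrib])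
      show "\<exists>k. prob {\<omega> \<in> space P. 1 < power_variation T p (\<epsilon> k) \<omega>} < (1 / 2) ^ 0"
        using order_tendstoD(2)[OF lim, of 1] by (auto dest!: eventually_happens)
      fix k n :: nat
      have "\<forall>\<^sub>F k' in sequentially. prob {\<omega> \<in> space P. 1 < power_variation T p (\<epsilon> k') \<omega>} < (1 / 2) ^ Suc n \<and> k < k'"
        by (intro eventually_conj order_tendstoD(2)[OF lim] eventually_gt_at_top) simp
      then show "\<exists>k'. prob {\<omega> \<in> space P. 1 < power_variation T p (\<epsilon> k') \<omega>} < (1 / 2) ^ Suc n \<and> k < k'"
        by (auto dest!: eventually_happens)
    qed
    then show ?thesis
      by (auto simp: strict_mono_Suc_iff)
  qed
  then obtain r where r: "strict_mono r" "\<And>n. prob {\<omega> \<in> space P. 1 < power_variation T p (\<epsilon> (r n)) \<omega>} < (1 / 2) ^ n"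
    by blast
  have "AE \<omega> in P. \<forall>\<^sub>F n in sequentially. \<omega> \<in> space P - {\<omega> \<in> space P. 1 < power_variation T p (\<epsilon> (r n)) \<omega>}"
  proof (rule borel_cantelli_AE1)
    show "summable (\<lambda>n. prob {\<omega> \<in> space P. 1 < power_variation T p (\<epsilon> (r n)) \<omega>})"
      using r(2) by (intro summable_comparison_test[OF _ summable_geometric[of "1 / 2"]]) (auto intro!: less_imp_le)
  qed (auto simp: less_top[symmetric])
  then have "AE \<omega> in P. \<forall>\<^sub>F n in sequentially. power_variation T p (\<epsilon> (r n)) \<omega> \<le> 1"
    by eventually_elim (auto elim!: eventually_mono simp: not_less)
  with r(1) show ?thesis
    using that by blast
qed

end

section \<open>Stochastic measures\<close>

text \<open>
  Identities between values of a stochastic measure are obtained from limits of probabilities; this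
  turns them into almost sure identities.
\<close>

lemma (in prob_space) AE_zero_of_prob_gt:
  fixes Z :: "'a \<Rightarrow> real"
  assumes [measurable]: "Z \<in> borel_measurable M" and null: "\<And>e. e > 0 \<Longrightarrow> prob {\<omega> \<in> space M. e < \<bar>Z \<omega>\<bar>} = 0"
  shows "AE \<omega> in M. Z \<omega> = 0"
proof -
  have "AE \<omega> in M. \<forall>n. \<not> (1 / real (Suc n) < \<bar>Z \<omega>\<bar>)"
    unfolding AE_all_countable
  proof
    fix n
    have "AE \<omega> in M. \<omega> \<notin> {\<omega> \<in> space M. 1 / real (Suc n) < \<bar>Z \<omega>\<bar>}"
      using null[of "1 / real (Suc n)"] by (intro AE_not_in) (auto simp: null_sets_def emeasure_eq_measure)
    with AE_space show "AE \<omega> in M. \<not> (1 / real (Suc n) < \<bar>Z \<omega>\<bar>)"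
      by eventually_elim auto
  qed
  then show ?thesis
  proof eventually_elim
    fix \<omega> assume small: "\<forall>n. \<not> (1 / real (Suc n) < \<bar>Z \<omega>\<bar>)"
    show "Z \<omega> = 0"
    proof (rule ccontr)
      assume "Z \<omega> \<noteq> 0"
      then obtain n where "inverse (real (Suc n)) < \<bar>Z \<omega>\<bar>"
        using reals_Archimedean[of "\<bar>Z \<omega>\<bar>"] by auto
      then show False
        using small by (simp add: inverse_eq_divide)
    qed
  qed
qed

text \<open>
  Additivity on finite families is derived from the defining series, whose limit is unique up to null sets.
\<close>

locale stoch_measure = prob_space P for P :: "'w measure" +
  fixes N :: "'x measure" and \<mu> :: "'x set \<Rightarrow> 'w \<Rightarrow> real"
  assumes stoch: "stochastic_measure P N \<mu>"
begin

lemma meas[measurable]: "A \<in> sets N \<Longrightarrow> \<mu> A \<in> borel_measurable P"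
  using stoch by (simp add: stochastic_measure_def)

lemma sums:
  fixes A :: "nat \<Rightarrow> 'x set"
  assumes "range A \<subseteq> sets N" "disjoint_family A" "e > 0"
  shows "(\<lambda>n. prob {\<omega> \<in> space P. e < \<bar>(\<Sum>k<n. \<mu> (A k) \<omega>) - \<mu> (\<Union>k. A k) \<omega>\<bar>}) \<longlonglongrightarrow> 0"
  using stoch assms unfolding stochastic_measure_def conv_in_prob_def by blast

lemma terms_vanish:
  fixes A :: "nat \<Rightarrow> 'x set"
  assumes A: "range A \<subseteq> sets N" "disjoint_family A" and e: "e > 0"
  shows "(\<lambda>n. prob {\<omega> \<in> space P. e \<le> \<bar>\<mu> (A n) \<omega>\<bar>}) \<longlonglongrightarrow> 0"
proof -
  have [measurable]: "\<mu> (A k) \<in> borel_measurable P" "\<mu> (\<Union>k. A k) \<in> borel_measurable P" for k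
    using A by auto
  let ?D = "\<lambda>n \<omega>. (\<Sum>k<n. \<mu> (A k) \<omega>) - \<mu> (\<Union>k. A k) \<omega>"
  let ?p = "\<lambda>n. prob {\<omega> \<in> space P. e / 3 < \<bar>?D n \<omega>\<bar>}"
  have p: "?p \<longlonglongrightarrow> 0"
    using e by (intro sums A) simp
  have upper: "prob {\<omega> \<in> space P. e \<le> \<bar>\<mu> (A n) \<omega>\<bar>} \<le> ?p (Suc n) + ?p n" for n
  proof -
    have "{\<omega> \<in> space P. e \<le> \<bar>\<mu> (A n) \<omega>\<bar>}
        \<subseteq> {\<omega> \<in> space P. e / 3 < \<bar>?D (Suc n) \<omega>\<bar>} \<union> {\<omega> \<in> space P. e / 3 < \<bar>?D n \<omega>\<bar>}"
    proof
      fix \<omega> assume \<omega>: "\<omega> \<in> {\<omega> \<in> space P. e \<le> \<bar>\<mu> (A n) \<omega>\<bar>}"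
      have "\<mu> (A n) \<omega> = ?D (Suc n) \<omega> - ?D n \<omega>"
        by simp
      then have "e / 3 < \<bar>?D (Suc n) \<omega>\<bar> \<or> e / 3 < \<bar>?D n \<omega>\<bar>"
        using \<omega> e by (simp only: mem_Collect_eq) linarith
      then show "\<omega> \<in> {\<omega> \<in> space P. e / 3 < \<bar>?D (Suc n) \<omega>\<bar>} \<union> {\<omega> \<in> space P. e / 3 < \<bar>?D n \<omega>\<bar>}"
        using \<omega> by blast
    qed
    then have "prob {\<omega> \<in> space P. e \<le> \<bar>\<mu> (A n) \<omega>\<bar>}
        \<le> prob ({\<omega> \<in> space P. e / 3 < \<bar>?D (Suc n) \<omega>\<bar>} \<union> {\<omega> \<in> space P. e / 3 < \<bar>?D n \<omega>\<bar>})"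
      by (intro finite_measure_mono) measurable
    also have "\<dots> \<le> ?p (Suc n) + ?p n"
      by (intro measure_Un_le) measurable
    finally show ?thesis .
  qed
  have "(\<lambda>n. ?p (Suc n) + ?p n) \<longlonglongrightarrow> 0 + 0"
    by (intro tendsto_add LIMSEQ_Suc p)
  then have lim: "(\<lambda>n. ?p (Suc n) + ?p n) \<longlonglongrightarrow> 0"
    by simp
  show ?thesis
    by (rule tendsto_sandwich[OF _ always_eventually[OF allI[OF upper]] tendsto_const lim]) simp
qed

text \<open>
  The constant sequence of empty sets is disjoint, and its terms tend to 0.
\<close>

lemma empty_AE: "AE \<omega> in P. \<mu> {} \<omega> = 0"
proof (rule AE_zero_of_prob_gt)
  fix e :: real assume e: "e > 0"
  have "(\<lambda>n::nat. prob {\<omega> \<in> space P. e / 2 \<le> \<bar>\<mu> {} \<omega>\<bar>}) \<longlonglongrightarrow> 0"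
    using terms_vanish[of "\<lambda>_. {}" "e / 2"] e by (simp add: disjoint_family_on_def)
  then have "prob {\<omega> \<in> space P. e / 2 \<le> \<bar>\<mu> {} \<omega>\<bar>} = 0"
    by (simp add: LIMSEQ_const_iff)
  moreover have "prob {\<omega> \<in> space P. e < \<bar>\<mu> {} \<omega>\<bar>} \<le> prob {\<omega> \<in> space P. e / 2 \<le> \<bar>\<mu> {} \<omega>\<bar>}"
    using e by (intro finite_measure_mono) auto
  ultimately show "prob {\<omega> \<in> space P. e < \<bar>\<mu> {} \<omega>\<bar>} = 0"
    by (simp add: measure_le_0_iff)
qed simp

lemma Un_AE:
  assumes [measurable]: "A \<in> sets N" "B \<in> sets N" and "A \<inter> B = {}"
  shows "AE \<omega> in P. \<mu> (A \<union> B) \<omega> = \<mu> A \<omega> + \<mu> B \<omega>"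
proof -
  define C where "C n = (if n = 0 then A else if n = 1 then B else {})" for n :: nat
  have C: "range C \<subseteq> sets N" "disjoint_family C" "(\<Union>n. C n) = A \<union> B"
    using assms by (auto simp: C_def disjoint_family_on_def split: if_splits)
  have sum: "(\<Sum>k<n + 2. \<mu> (C k) \<omega>) = \<mu> A \<omega> + \<mu> B \<omega>" if "\<mu> {} \<omega> = 0" for n \<omega>
    using that by (induction n) (simp_all add: C_def numeral_2_eq_2)
  have "AE \<omega> in P. \<mu> A \<omega> + \<mu> B \<omega> - \<mu> (A \<union> B) \<omega> = 0"
  proof (rule AE_zero_of_prob_gt)
    fix e :: real assume e: "e > 0"
    let ?p = "\<lambda>n. prob {\<omega> \<in> space P. e < \<bar>(\<Sum>k<n. \<mu> (C k) \<omega>) - \<mu> (\<Union>k. C k) \<omega>\<bar>}"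
    have [measurable]: "\<mu> (C k) \<in> borel_measurable P" for k
      using C(1) by auto
    have "?p (n + 2) = prob {\<omega> \<in> space P. e < \<bar>\<mu> A \<omega> + \<mu> B \<omega> - \<mu> (A \<union> B) \<omega>\<bar>}" for n
      unfolding C(3)
    proof (rule measure_eq_AE)
      show "AE \<omega> in P. (\<omega> \<in> {\<omega> \<in> space P. e < \<bar>(\<Sum>k<n + 2. \<mu> (C k) \<omega>) - \<mu> (A \<union> B) \<omega>\<bar>}) =
          (\<omega> \<in> {\<omega> \<in> space P. e < \<bar>\<mu> A \<omega> + \<mu> B \<omega> - \<mu> (A \<union> B) \<omega>\<bar>})"
        using empty_AE by eventually_elim (simp only: sum mem_Collect_eq)
    qed measurable
    moreover have "(\<lambda>n. ?p (n + 2)) \<longlonglongrightarrow> 0"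
      using sums[OF C(1,2) e] by (rule LIMSEQ_ignore_initial_segment)
    ultimately show "prob {\<omega> \<in> space P. e < \<bar>\<mu> A \<omega> + \<mu> B \<omega> - \<mu> (A \<union> B) \<omega>\<bar>} = 0"
      by (simp add: LIMSEQ_const_iff)
  qed simp
  then show ?thesis
    by eventually_elim simp
qed

lemma UN_AE:
  assumes "finite I" "disjoint_family_on A I" "\<And>i. i \<in> I \<Longrightarrow> A i \<in> sets N"
  shows "AE \<omega> in P. \<mu> (\<Union>i\<in>I. A i) \<omega> = (\<Sum>i\<in>I. \<mu> (A i) \<omega>)"
  using assms
proof (induction I rule: finite_induct)
  case empty
  then show ?case
    using empty_AE by simp
next
  case (insert j I)
  have "AE \<omega> in P. \<mu> (A j \<union> (\<Union>i\<in>I. A i)) \<omega> = \<mu> (A j) \<omega> + \<mu> (\<Union>i\<in>I. A i) \<omega>"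
    using insert by (intro Un_AE sets.finite_UN) (auto simp: disjoint_family_on_def)
  moreover have "AE \<omega> in P. \<mu> (\<Union>i\<in>I. A i) \<omega> = (\<Sum>i\<in>I. \<mu> (A i) \<omega>)"
    using insert by (intro insert.IH) (auto simp: disjoint_family_on_def)
  ultimately show ?case
    by eventually_elim (use insert.hyps in simp)
qed

end

lemma borel_subset_in_restrict:
  "A \<in> sets borel \<Longrightarrow> A \<subseteq> {0..T} \<Longrightarrow> A \<in> sets (restrict_space borel {0..T::real})"
  by (auto simp: sets_restrict_space_iff)

lemma stopped_process:
  assumes "prob_space P" "0 \<le> T" and X: "continuous_process P T X"
  shows "bounded_uc_process P (\<lambda>t. X (max 0 (min T t)))"
proof -
  interpret prob_space P by fact
  let ?c = "\<lambda>t. max 0 (min T t)"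
  have c: "?c t \<in> {0..T}" for t
    using assms(2) by auto
  show ?thesis
  proof
    show "X (?c t) \<in> borel_measurable P" for t
      using X c[of t] by (simp add: continuous_process_def)
    fix \<omega> assume "\<omega> \<in> space P"
    then have cont: "continuous_on {0..T} (\<lambda>t. X t \<omega>)"
      using X by (simp add: continuous_process_def)
    have "uniformly_continuous_on {0..T} (\<lambda>t. X t \<omega>)"
      using cont by (intro compact_uniformly_continuous) auto
    moreover have "\<bar>?c s - ?c t\<bar> \<le> \<bar>s - t\<bar>" for s t
      by (auto simp: max_def min_def)
    ultimately show "uniformly_continuous_on UNIV (\<lambda>t. X (?c t) \<omega>)"
      using c unfolding uniformly_continuous_on_def dist_real_def
      by (meson UNIV_I le_less_trans)
    have "bounded ((\<lambda>t. X t \<omega>) ` {0..T})"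
      using cont by (intro compact_imp_bounded compact_continuous_image) auto
    then obtain B where "\<forall>t\<in>{0..T}. \<bar>X t \<omega>\<bar> \<le> B"
      by (auto simp: bounded_iff)
    then show "\<exists>B. \<forall>t. \<bar>X (?c t) \<omega>\<bar> \<le> B"
      using c by blast
  qed
qed

text \<open>
  Used to pass from the stopped process to the given one, whose increments from times in $[0,T_1]$ are the same for $\varepsilon < T-T_1$.
\<close>

lemma conv_in_prob_cong:
  assumes "conv_in_prob P Y' Z F" and ev: "\<forall>\<^sub>F i in F. Y i = Y' i"
  shows "conv_in_prob P Y Z F"
  unfolding conv_in_prob_def
proof (intro conjI allI impI)
  have Y': "\<forall>\<^sub>F i in F. Y' i \<in> borel_measurable P" "Z \<in> borel_measurable P"
    "\<And>e. e > 0 \<Longrightarrow> ((\<lambda>i. measure P {\<omega> \<in> space P. e < \<bar>Y' i \<omega> - Z \<omega>\<bar>}) \<longlongrightarrow> 0) F"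
    using assms(1) by (auto simp: conv_in_prob_def)
  show "\<forall>\<^sub>F i in F. Y i \<in> borel_measurable P"
    using Y'(1) ev by eventually_elim simp
  show "Z \<in> borel_measurable P"
    by (fact Y')
  fix e :: real assume "e > 0"
  then show "((\<lambda>i. measure P {\<omega> \<in> space P. e < \<bar>Y i \<omega> - Z \<omega>\<bar>}) \<longlongrightarrow> 0) F"
    by (rule Lim_transform_eventually[OF Y'(3)]) (use ev in \<open>eventually_elim; simp\<close>)
qed

lemma unif_conv_in_prob_cong:
  assumes "unif_conv_in_prob P S Y' Z F" and ev: "\<forall>\<^sub>F i in F. \<forall>t\<in>S. Y i t = Y' i t"
  shows "unif_conv_in_prob P S Y Z F"
  unfolding unif_conv_in_prob_def
proof (intro conjI allI impI ballI)
  have Y': "\<And>t. t \<in> S \<Longrightarrow> \<forall>\<^sub>F i in F. Y' i t \<in> borel_measurable P" "\<And>t. t \<in> S \<Longrightarrow> Z t \<in> borel_measurable P"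
    "\<forall>\<^sub>F i in F. (\<lambda>\<omega>. SUP t\<in>S. ennreal \<bar>Y' i t \<omega> - Z t \<omega>\<bar>) \<in> borel_measurable P"
    "\<And>e. e > 0 \<Longrightarrow> ((\<lambda>i. measure P {\<omega> \<in> space P. ennreal e < (SUP t\<in>S. ennreal \<bar>Y' i t \<omega> - Z t \<omega>\<bar>)}) \<longlongrightarrow> 0) F"
    using assms(1) by (auto simp: unif_conv_in_prob_def)
  have sup: "\<forall>\<^sub>F i in F. (\<lambda>\<omega>. SUP t\<in>S. ennreal \<bar>Y' i t \<omega> - Z t \<omega>\<bar>) = (\<lambda>\<omega>. SUP t\<in>S. ennreal \<bar>Y i t \<omega> - Z t \<omega>\<bar>)"
    using ev by eventually_elim simp
  show "Z t \<in> borel_measurable P" if "t \<in> S" for t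
    using that by (fact Y')
  show "\<forall>\<^sub>F i in F. Y i t \<in> borel_measurable P" if "t \<in> S" for t
    using Y'(1)[OF that] ev by eventually_elim (simp add: that)
  show "\<forall>\<^sub>F i in F. (\<lambda>\<omega>. SUP t\<in>S. ennreal \<bar>Y i t \<omega> - Z t \<omega>\<bar>) \<in> borel_measurable P"
    using Y'(3) sup by eventually_elim simp
  fix e :: real assume "e > 0"
  then show "((\<lambda>i. measure P {\<omega> \<in> space P. ennreal e < (SUP t\<in>S. ennreal \<bar>Y i t \<omega> - Z t \<omega>\<bar>)}) \<longlongrightarrow> 0) F"
    by (rule Lim_transform_eventually[OF Y'(4)]) (use sup in \<open>eventually_elim; simp add: fun_eq_iff\<close>)
qed

lemma bdd_above_range_of_eventually_le:
  fixes f :: "nat \<Rightarrow> real"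
  assumes "\<forall>\<^sub>F i in sequentially. f i \<le> b"
  shows "bdd_above (range f)"
proof -
  obtain n where n: "\<And>i. n \<le> i \<Longrightarrow> f i \<le> b"
    using assms by (auto simp: eventually_sequentially)
  have "f i \<in> f ` {..<n} \<union> {..b}" for i
    using n[of i] by (cases "i < n") auto
  then have "range f \<subseteq> f ` {..<n} \<union> {..b}"
    by blast
  then show ?thesis
    by (rule bdd_above_mono[rotated]) simp
qed

theorem corollary3p2:
  fixes P :: "'w measure" and T T1 :: real
    and \<mu> :: "real set \<Rightarrow> 'w \<Rightarrow> real" and X :: "real \<Rightarrow> 'w \<Rightarrow> real" and m :: "real measure"
  assumes "prob_space P" and "complete_measure P"
    and "0 < T"
    and "stochastic_measure P (restrict_space borel {0..T}) \<mu>"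
    and "continuous_process P T X"
    and "\<And>t. t \<in> {0..T} \<Longrightarrow> AE \<omega> in P. X t \<omega> = \<mu> {0<..t} \<omega>"
    and "finite_measure m" and "sets m = sets (restrict_space borel {0..T})"
    and "\<And>h :: real \<Rightarrow> real. h \<in> borel_measurable (restrict_space borel {0..T}) \<Longrightarrow>
           (\<integral>\<^sup>+ x. ennreal ((h x)\<^sup>2) \<partial>m) < \<infinity> \<Longrightarrow>
           stoch_integrable P (restrict_space borel {0..T}) \<mu> h"
    and "0 < T1" and "T1 < T"
  shows "(\<forall>\<delta>>0. conv_in_prob P
            (\<lambda>\<epsilon> \<omega>. 1 / \<epsilon> * (LINT s:{0..T1}|lborel. \<bar>X (s + \<epsilon>) \<omega> - X s \<omega>\<bar> powr (2 + \<delta>)))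
            (\<lambda>\<omega>. 0) (at_right 0)) \<and>
         has_strong_variation P T X 3 T1 (\<lambda>t \<omega>. 0)"
proof -
  define S where "S t = X (max 0 (min T t))" for t
  have S: "S t = X t" if "t \<in> {0..T}" for t
    using that by (auto simp: S_def)
  interpret \<mu>: stoch_measure P "restrict_space borel {0..T}" \<mu>
    using assms(1,4) by (intro stoch_measure.intro stoch_measure_axioms.intro)
  interpret S: bounded_uc_process P S
    unfolding S_def using assms(1,3,5) by (intro stopped_process) auto
  have incr: "AE \<omega> in P. \<mu> {s<..t} \<omega> = S t \<omega> - S s \<omega>" if st: "0 \<le> s" "s \<le> t" "t \<le> T" for s t
  proof -
    have union: "{0<..s} \<union> {s<..t} = {0<..t}"
      using st by auto
    have "AE \<omega> in P. \<mu> ({0<..s} \<union> {s<..t}) \<omega> = \<mu> {0<..s} \<omega> + \<mu> {s<..t} \<omega>"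
      using st by (intro \<mu>.Un_AE borel_subset_in_restrict) auto
    moreover have "AE \<omega> in P. X s \<omega> = \<mu> {0<..s} \<omega>" "AE \<omega> in P. X t \<omega> = \<mu> {0<..t} \<omega>"
      using st by (auto intro: assms(6))
    ultimately have "AE \<omega> in P. \<mu> {s<..t} \<omega> = X t \<omega> - X s \<omega>"
      unfolding union by eventually_elim simp
    then show ?thesis
      using st by (simp add: S)
  qed
  have bdd: "\<not> S.energy_unbounded {0<..T1} a" if "a > 0" for a
  proof (rule S.no_energy_unbounded[OF _ _ _ that, where \<mu> = \<mu>])
    fix A :: "nat set" and s :: "nat \<Rightarrow> real" and \<epsilon> :: real
    assume A: "finite A" "\<epsilon> > 0" "disjoint_family_on (\<lambda>k. {s k<..s k + \<epsilon>}) A"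
      "(\<Union>k\<in>A. {s k<..s k + \<epsilon>}) \<subseteq> {0<..T1}"
    have loc: "0 \<le> s k" "s k + \<epsilon> \<le> T1" if "k \<in> A" for k
    proof -
      have sub: "{s k<..s k + \<epsilon>} \<subseteq> {0<..T1}"
        using A(4) that by blast
      from subsetD[OF this, of "s k + \<epsilon>"] show "s k + \<epsilon> \<le> T1"
        using A(2) by auto
      show "0 \<le> s k"
      proof (rule ccontr)
        assume "\<not> 0 \<le> s k"
        then have "min 0 (s k + \<epsilon>) \<in> {s k<..s k + \<epsilon>}"
          using A(2) by auto
        from subsetD[OF sub this] show False
          by auto
      qed
    qed
    have "AE \<omega> in P. \<mu> (\<Union>k\<in>A. {s k<..s k + \<epsilon>}) \<omega> = (\<Sum>k\<in>A. \<mu> {s k<..s k + \<epsilon>} \<omega>)"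
    proof (rule \<mu>.UN_AE[OF A(1,3)])
      show "{s k<..s k + \<epsilon>} \<in> sets (restrict_space borel {0..T})" if "k \<in> A" for k
        using loc[OF that] assms(11) by (intro borel_subset_in_restrict) auto
    qed
    moreover have "AE \<omega> in P. \<forall>k\<in>A. \<mu> {s k<..s k + \<epsilon>} \<omega> = S (s k + \<epsilon>) \<omega> - S (s k) \<omega>"
      using A(1,2) loc assms(11) by (intro AE_finite_allI incr) force+
    ultimately show "AE \<omega> in P. \<mu> (\<Union>k\<in>A. {s k<..s k + \<epsilon>}) \<omega> = (\<Sum>k\<in>A. S (s k + \<epsilon>) \<omega> - S (s k) \<omega>)"
      by eventually_elim simp
  next
    fix R :: "real set"
    assume "R \<in> sets borel" "R \<subseteq> {0<..T1}"
    then show "\<mu> R \<in> borel_measurable P"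
      using assms(11) by (intro \<mu>.meas borel_subset_in_restrict) auto
  next
    fix R :: "nat \<Rightarrow> real set"
    assume R: "disjoint_family R" "\<And>n. R n \<in> sets borel" "\<And>n. R n \<subseteq> {0<..T1}"
    have "R n \<in> sets (restrict_space borel {0..T})" for n
      using R(2,3)[of n] assms(11) by (intro borel_subset_in_restrict) auto
    then show "(\<lambda>n. measure P {\<omega> \<in> space P. 1 \<le> \<bar>\<mu> (R n) \<omega>\<bar>}) \<longlonglongrightarrow> 0"
      using R(1) by (intro \<mu>.terms_vanish) auto
  qed
  have power_variation: "1 / \<epsilon> * (LINT s:{0..T1}|lborel. \<bar>X (s + \<epsilon>) \<omega> - X s \<omega>\<bar> powr p) = S.power_variation T1 p \<epsilon> \<omega>"
    and cubic_variation: "t \<le> T1 \<Longrightarrow> 1 / \<epsilon> * (LINT s:{0..t}|lborel. (X (s + \<epsilon>) \<omega> - X s \<omega>) ^ 3) = S.cubic_variation \<epsilon> t \<omega>"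
    if "0 < \<epsilon>" "\<epsilon> < T - T1" for \<epsilon> p \<omega> t
    using that by (auto simp: S.power_variation_def S.cubic_variation_def S intro!: set_lebesgue_integral_cong)
  have small: "\<forall>\<^sub>F \<epsilon> in at_right 0. 0 < \<epsilon> \<and> \<epsilon> < T - T1"
    using assms(11) by (auto simp: eventually_at_right_field intro!: exI[of _ "T - T1"])
  have power_variation_conv: "conv_in_prob P
      (\<lambda>\<epsilon> \<omega>. 1 / \<epsilon> * (LINT s:{0..T1}|lborel. \<bar>X (s + \<epsilon>) \<omega> - X s \<omega>\<bar> powr (2 + \<delta>))) (\<lambda>\<omega>. 0) (at_right 0)"
    if "\<delta> > 0" for \<delta>
  proof (rule conv_in_prob_cong)
    show "conv_in_prob P (S.power_variation T1 (2 + \<delta>)) (\<lambda>\<omega>. 0) (at_right 0)"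
      using that by (intro S.power_variation_conv bdd) auto
    show "\<forall>\<^sub>F \<epsilon> in at_right 0. (\<lambda>\<omega>. 1 / \<epsilon> * (LINT s:{0..T1}|lborel. \<bar>X (s + \<epsilon>) \<omega> - X s \<omega>\<bar> powr (2 + \<delta>)))
        = S.power_variation T1 (2 + \<delta>) \<epsilon>"
      using small by eventually_elim (intro ext power_variation; simp)
  qed
  have cubic_variation_conv: "unif_conv_in_prob P {0..T1}
      (\<lambda>\<epsilon> t \<omega>. 1 / \<epsilon> * (LINT s:{0..t}|lborel. (X (s + \<epsilon>) \<omega> - X s \<omega>) ^ 3)) (\<lambda>t \<omega>. 0) (at_right 0)"
  proof (rule unif_conv_in_prob_cong)
    show "unif_conv_in_prob P {0..T1} S.cubic_variation (\<lambda>t \<omega>. 0) (at_right 0)"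
      using assms(10) by (intro S.cubic_variation_conv bdd) auto
    show "\<forall>\<^sub>F \<epsilon> in at_right 0. \<forall>t\<in>{0..T1}.
        (\<lambda>\<omega>. 1 / \<epsilon> * (LINT s:{0..t}|lborel. (X (s + \<epsilon>) \<omega> - X s \<omega>) ^ 3)) = S.cubic_variation \<epsilon> t"
      using small by eventually_elim (intro ballI ext cubic_variation; simp)
  qed
  have subseq: "\<exists>r :: nat \<Rightarrow> nat. strict_mono r \<and> (AE \<omega> in P. bdd_above (range (\<lambda>i.
      1 / \<epsilon> (r i) * (LINT s:{0..T1}|lborel. \<bar>X (s + \<epsilon> (r i)) \<omega> - X s \<omega>\<bar> ^ 3))))"
    if \<epsilon>: "\<forall>i. 0 < \<epsilon> i" "\<epsilon> \<longlonglongrightarrow> 0" for \<epsilon> :: "nat \<Rightarrow> real"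
  proof -
    obtain r where r: "strict_mono r"
      and AE: "AE \<omega> in P. \<forall>\<^sub>F i in sequentially. S.power_variation T1 3 (\<epsilon> (r i)) \<omega> \<le> 1"
      by (rule S.power_variation_subseq_bounded[of T1 3 \<epsilon>]) (use bdd \<epsilon> in auto)
    have "(\<lambda>i. \<epsilon> (r i)) \<longlonglongrightarrow> 0"
      using LIMSEQ_subseq_LIMSEQ[OF \<epsilon>(2) r] by (simp add: comp_def)
    from order_tendstoD(2)[OF this, of "T - T1"]
    have ev: "\<forall>\<^sub>F i in sequentially. \<epsilon> (r i) < T - T1"
      using assms(11) by simp
    have "AE \<omega> in P. bdd_above (range (\<lambda>i.
      1 / \<epsilon> (r i) * (LINT s:{0..T1}|lborel. \<bar>X (s + \<epsilon> (r i)) \<omega> - X s \<omega>\<bar> ^ 3)))"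
      using AE
    proof eventually_elim
      fix \<omega> assume "\<forall>\<^sub>F i in sequentially. S.power_variation T1 3 (\<epsilon> (r i)) \<omega> \<le> 1"
      with ev have "\<forall>\<^sub>F i in sequentially.
          1 / \<epsilon> (r i) * (LINT s:{0..T1}|lborel. \<bar>X (s + \<epsilon> (r i)) \<omega> - X s \<omega>\<bar> ^ 3) \<le> 1"
      proof eventually_elim
        fix i assume i: "\<epsilon> (r i) < T - T1" "S.power_variation T1 3 (\<epsilon> (r i)) \<omega> \<le> 1"
        have "1 / \<epsilon> (r i) * (LINT s:{0..T1}|lborel. \<bar>X (s + \<epsilon> (r i)) \<omega> - X s \<omega>\<bar> ^ 3)
            = 1 / \<epsilon> (r i) * (LINT s:{0..T1}|lborel. \<bar>X (s + \<epsilon> (r i)) \<omega> - X s \<omega>\<bar> powr 3)"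
          by simp
        also have "\<dots> = S.power_variation T1 3 (\<epsilon> (r i)) \<omega>"
          using \<epsilon>(1) i(1) by (intro power_variation) auto
        finally show "1 / \<epsilon> (r i) * (LINT s:{0..T1}|lborel. \<bar>X (s + \<epsilon> (r i)) \<omega> - X s \<omega>\<bar> ^ 3) \<le> 1"
          using i(2) by simp
      qed
      then show "bdd_above (range (\<lambda>i.
          1 / \<epsilon> (r i) * (LINT s:{0..T1}|lborel. \<bar>X (s + \<epsilon> (r i)) \<omega> - X s \<omega>\<bar> ^ 3)))"
        by (rule bdd_above_range_of_eventually_le)
    qed
    then show ?thesis
      using r by blast
  qed
  show ?thesis
    using power_variation_conv cubic_variation_conv subseq assms(5,11) unfolding has_strong_variation_def by blast
qed

end
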